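(* Let $\mathcal{H}$ be a reproducing kernel Hilbert space on a non-empty set $\Omega$, let $n\geq 1$ be an integer and let $A_i\in\mathcal{B}(\mathcal{H})$ for $i=1,2,\ldots,n$. Then for all $r\geq 1$, $$\mathbf{ber}^{2r}\left(\sum_{i=1}^{n}A_i\right) \leq \frac{n^{2r-1}}{4}\mathbf{ber}\left(\sum_{i=1}^{n}\left(|A_i|^{2r}+|A_i^*|^{2r}\right)\right)+\frac{n^{2r-1}}{2}\left(\sum_{i=1}^{n}\mathbf{ber}\left(|A_i|^{r}|A_i^*|^r\right)\right).$$
   Context: Let $\mathbb{F}$ be $\mathbb{R}$ or $\mathbb{C}$ and $\Omega$ a non-empty set. A reproducing kernel Hilbert space $\mathcal{H}$ on $\Omega$ is a Hilbert space over $\mathbb{F}$ consisting of functions $\Omega\to\mathbb{F}$ such that every evaluation $f\mapsto f(\lambda)$, $\lambda\in\Omega$, is bounded. For $\lambda\in\Omega$, $k_\lambda\in\mathcal{H}$ is the unique vector with $f(\lambda)=\langle f,k_\lambda\rangle$ for all $f\in\mathcal{H}$; it is assumed that $k_\lambda\neq 0$ for every $\lambda$, and $\hat{k}_\lambda=k_\lambda/\|k_\lambda\|$. $\mathcal{B}(\mathcal{H})$ is the set of bounded linear operators on $\mathcal{H}$. The Berezin number of $A\in\mathcal{B}(\mathcal{H})$ is $\mathbf{ber}(A)=\sup_{\lambda\in\Omega}|\langle A\hat{k}_\lambda,\hat{k}_\lambda\rangle|$, and $\mathbf{ber}^{s}(A)$ means $(\mathbf{ber}(A))^{s}$. $|A|=(A^*A)^{1/2}$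 and $|A^*|=(AA^* )^{1/2}$; real powers of positive operators are taken by the continuous functional calculus. *)

theory Defs
  imports
    "HOL-Analysis.Analysis"
    "HOL-Computational_Algebra.Polynomial"
    "HOL-Library.Function_Algebras"
begin

text \<open>
  The scalar field, a subset of the complex numbers, is either \<open>\<real>\<close> or everything, so that real and
  complex spaces are treated uniformly.  A function on the point set \<open>\<Omega>\<close> is represented by a
  function on the whole type that vanishes outside \<open>\<Omega>\<close>.  Sums, differences and zero of functions
  (and of operators) are the pointwise ones from Function_Algebras.
\<close>

record 'o function_space =
  scalars :: "complex set"
  points :: "'o set"
  vecs :: "('o \<Rightarrow> complex) set"
  ip :: "('o \<Rightarrow> complex) \<Rightarrow> ('o \<Rightarrow> complex) \<Rightarrow> complex"

type_synonym 'o operator = "('o \<Rightarrow> complex) \<Rightarrow> ('o \<Rightarrow> complex)"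

definition smul :: "complex \<Rightarrow> ('o \<Rightarrow> complex) \<Rightarrow> ('o \<Rightarrow> complex)" where
  "smul c f = (\<lambda>x. c * f x)"

definition nrm :: "'o function_space \<Rightarrow> ('o \<Rightarrow> complex) \<Rightarrow> real" where
  "nrm X f = sqrt (Re (ip X f f))"

locale hilbert_function_space =
  fixes X :: "'o function_space"
  assumes scalars_real_or_complex: "scalars X = \<real> \<or> scalars X = UNIV"
    and points_nonempty: "points X \<noteq> {}"
    and vecs_values: "f \<in> vecs X \<Longrightarrow> f x \<in> scalars X"
    and vecs_outside: "f \<in> vecs X \<Longrightarrow> x \<notin> points X \<Longrightarrow> f x = 0"
    and zero_vecs: "0 \<in> vecs X"
    and add_vecs: "f \<in> vecs X \<Longrightarrow> g \<in> vecs X \<Longrightarrow> f + g \<in> vecs X"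
    and smul_vecs: "c \<in> scalars X \<Longrightarrow> f \<in> vecs X \<Longrightarrow> smul c f \<in> vecs X"
    and ip_scalar: "f \<in> vecs X \<Longrightarrow> g \<in> vecs X \<Longrightarrow> ip X f g \<in> scalars X"
    and ip_add: "f \<in> vecs X \<Longrightarrow> g \<in> vecs X \<Longrightarrow> h \<in> vecs X \<Longrightarrow> ip X (f + g) h = ip X f h + ip X g h"
    and ip_smul: "c \<in> scalars X \<Longrightarrow> f \<in> vecs X \<Longrightarrow> g \<in> vecs X \<Longrightarrow> ip X (smul c f) g = c * ip X f g"
    and ip_cnj: "f \<in> vecs X \<Longrightarrow> g \<in> vecs X \<Longrightarrow> ip X g f = cnj (ip X f g)"
    and ip_nonneg: "f \<in> vecs X \<Longrightarrow> 0 \<le> Re (ip X f f)"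
    and ip_definite: "f \<in> vecs X \<Longrightarrow> ip X f f = 0 \<Longrightarrow> f = 0"
    and complete: "(\<And>n. u n \<in> vecs X) \<Longrightarrow>
          (\<And>e. 0 < e \<Longrightarrow> \<exists>N. \<forall>m\<ge>N. \<forall>n\<ge>N. nrm X (u m - u n) < e) \<Longrightarrow>
          \<exists>f\<in>vecs X. (\<lambda>n. nrm X (u n - f)) \<longlonglongrightarrow> 0"

definition kernel :: "'o function_space \<Rightarrow> 'o \<Rightarrow> ('o \<Rightarrow> complex)" where
  "kernel X x = (THE k. k \<in> vecs X \<and> (\<forall>f\<in>vecs X. f x = ip X f k))"

definition nkernel :: "'o function_space \<Rightarrow> 'o \<Rightarrow> ('o \<Rightarrow> complex)" where
  "nkernel X x = smul (complex_of_real (1 / nrm X (kernel X x))) (kernel X x)"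

locale rkhs = hilbert_function_space X for X :: "'o function_space" +
  assumes eval_bounded: "x \<in> points X \<Longrightarrow> \<exists>C. \<forall>f\<in>vecs X. cmod (f x) \<le> C * nrm X f"
    and kernel_nonzero: "x \<in> points X \<Longrightarrow> kernel X x \<noteq> 0"

text \<open>
  Bounded operators on the space are extended by zero to arguments outside the space, which makes
  equality of operators the equality of functions.
\<close>

definition bops :: "'o function_space \<Rightarrow> 'o operator set" where
  "bops X = {A.
     (\<forall>f\<in>vecs X. A f \<in> vecs X) \<and>
     (\<forall>f. f \<notin> vecs X \<longrightarrow> A f = 0) \<and>
     (\<forall>f\<in>vecs X. \<forall>g\<in>vecs X. A (f + g) = A f + A g) \<and>
     (\<forall>c\<in>scalars X. \<forall>f\<in>vecs X. A (smul c f) = smul c (A f)) \<and>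
     (\<exists>C. \<forall>f\<in>vecs X. nrm X (A f) \<le> C * nrm X f)}"

definition op_id :: "'o function_space \<Rightarrow> 'o operator" where
  "op_id X = (\<lambda>f. if f \<in> vecs X then f else 0)"

definition op_scale :: "complex \<Rightarrow> 'o operator \<Rightarrow> 'o operator" where
  "op_scale c A = (\<lambda>f. smul c (A f))"

definition op_norm :: "'o function_space \<Rightarrow> 'o operator \<Rightarrow> real" where
  "op_norm X A = (SUP f\<in>{f \<in> vecs X. nrm X f \<le> 1}. nrm X (A f))"

definition adj :: "'o function_space \<Rightarrow> 'o operator \<Rightarrow> 'o operator" where
  "adj X A = (THE B. B \<in> bops X \<and> (\<forall>f\<in>vecs X. \<forall>g\<in>vecs X. ip X (A f) g = ip X f (B g)))"

definition op_spectrum :: "'o function_space \<Rightarrow> 'o operator \<Rightarrow> complex set" where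
  "op_spectrum X A = {c \<in> scalars X. \<not> (\<exists>B\<in>bops X.
      B \<circ> (A - op_scale c (op_id X)) = op_id X \<and> (A - op_scale c (op_id X)) \<circ> B = op_id X)}"

definition op_poly :: "'o function_space \<Rightarrow> real poly \<Rightarrow> 'o operator \<Rightarrow> 'o operator" where
  "op_poly X p A =
     (\<Sum>i\<le>degree p. op_scale (complex_of_real (coeff p i)) ((A ^^ i) \<circ> op_id X))"

text \<open>
  Continuous functional calculus for a self-adjoint operator (whose spectrum is real) and a real
  function \<open>g\<close> that is continuous on the spectrum: \<open>g(A)\<close> is the norm limit of \<open>p\<^sub>n(A)\<close> whenever the
  polynomials \<open>p\<^sub>n\<close> converge to \<open>g\<close> uniformly on the spectrum.  By the Weierstrass theorem such
  sequences exist, so the limit is unique.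
\<close>

definition cfc :: "'o function_space \<Rightarrow> (real \<Rightarrow> real) \<Rightarrow> 'o operator \<Rightarrow> 'o operator" where
  "cfc X g A = (THE B. B \<in> bops X \<and>
     (\<forall>p :: nat \<Rightarrow> real poly.
        uniform_limit {t. complex_of_real t \<in> op_spectrum X A} (\<lambda>n. poly (p n)) g sequentially \<longrightarrow>
        (\<lambda>n. op_norm X (op_poly X (p n) A - B)) \<longlonglongrightarrow> 0))"

text \<open>Used for positive \<open>A\<close> and \<open>s > 0\<close> only; there \<open>0 powr s = 0\<close> is the right value.\<close>

definition op_powr :: "'o function_space \<Rightarrow> 'o operator \<Rightarrow> real \<Rightarrow> 'o operator" where
  "op_powr X A s = cfc X (\<lambda>t. t powr s) A"

definition op_abs :: "'o function_space \<Rightarrow> 'o operator \<Rightarrow> 'o operator" where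
  "op_abs X A = op_powr X (adj X A \<circ> A) (1 / 2)"

definition ber :: "'o function_space \<Rightarrow> 'o operator \<Rightarrow> real" where
  "ber X A = (SUP x\<in>points X. cmod (ip X (A (nkernel X x)) (nkernel X x)))"

end

theory Submission
  imports Defs "HOL-Computational_Algebra.Fundamental_Theorem_Algebra"
begin

text \<open>
The inequality is pointwise in the evaluation point: it suffices to bound
\<open>|\<langle>\<Sum>A\<^sub>i k, k\<rangle>|\<close> for one unit vector \<open>k\<close> (a normalised kernel) and then take the supremum.
By the triangle inequality and the power mean inequality (\<open>power_mean_powr\<close>) the sum costs the
factor \<open>n\<close> to the power \<open>2r - 1\<close>, which leaves one operator \<open>A\<close> at a time (\<open>unit_vector_estimate\<close>).

For a single \<open>A\<close> write \<open>P = |A|\<close> and \<open>Q = |A\<^sup>*|\<close>.  Four inequalities are chained: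
the mixed Schwarz inequality \<open>|\<langle>A k, k\<rangle>|\<^sup>2 \<le> \<langle>P k, k\<rangle> \<langle>Q k, k\<rangle>\<close> (\<open>mixed_schwarz\<close>);
McCarthy's inequality, which moves the exponent \<open>r\<close> from the numbers to the operators (\<open>mccarthy\<close>);
Buzano's inequality, which bounds \<open>\<langle>P\<^sup>r k, k\<rangle> \<langle>k, Q\<^sup>r k\<rangle>\<close> by half of
\<open>\<parallel>P\<^sup>r k\<parallel> \<parallel>Q\<^sup>r k\<parallel> + |\<langle>P\<^sup>r k, Q\<^sup>r k\<rangle>|\<close> (\<open>buzano\<close>); and the arithmetic-geometric mean inequality.
Since \<open>\<parallel>P\<^sup>r k\<parallel>\<^sup>2\<close> is the quadratic form of the power \<open>2r\<close> of \<open>P\<close> and \<open>\<langle>P\<^sup>r k, Q\<^sup>r k\<rangle>\<close> is the conjugate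
of \<open>\<langle>P\<^sup>r Q\<^sup>r k, k\<rangle>\<close>, this is the claim.

The powers are values of the continuous functional calculus, so the calculus has to be shown to
exist on real and complex spaces alike.  The key fact is that \<open>\<parallel>p(A)\<parallel>\<close> is at most every upper bound of
\<open>|p|\<close> on the real spectrum, for self-adjoint \<open>A\<close> and real polynomials \<open>p\<close> (\<open>op_poly_norm_bound\<close>).
One argument covers both fields: with \<open>N = \<parallel>p(A)\<parallel>\<close> the operator \<open>p(A)\<^sup>2 - N\<^sup>2\<close> is not bounded below, whereas factoring the real polynomial
\<open>p\<^sup>2 - N\<^sup>2\<close> into linear and irreducible quadratic factors shows that it would be bounded below if it
had no zero on the spectrum.  Order properties of the calculus, and with them McCarthy's inequality,
follow from this bound.  Adjoints, reproducing kernels and the inverses that confine the spectrum of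
a positive operator to an interval all come from one variational argument
(\<open>lax_milgram_selfadjoint\<close>).
\<close>

section \<open>Real inequalities and pointwise algebra\<close>

text \<open>
The discriminant of a quadratic function without negative values, in a form that keeps the
degenerate case of a vanishing leading coefficient: there the linear coefficient must vanish.
The Schwarz inequality uses the general case, the variational argument below the case \<open>a = 0\<close>.
\<close>

lemma quadratic_nonneg_imp:
  fixes a b s :: real
  assumes "\<And>t. 0 \<le> a + 2 * t * s + t\<^sup>2 * b"
  shows "s\<^sup>2 \<le> a * b"
proof (cases "b = 0")
  case True
  have "s = 0"
  proof (rule ccontr)
    assume "s \<noteq> 0"
    then show False
      using assms[of "- (a + 1) / (2 * s)"] True by (simp add: field_simps)
  qed
  then show ?thesis using True by simp
next
  case False
  have "b \<ge> 0"
  proof (rule ccontr)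
    assume "\<not> b \<ge> 0"
    then have b: "b < 0" by simp
    \<comment> \<open>With a negative leading coefficient the values at large \<open>t\<close> are negative; this \<open>t\<close> is large
      enough to absorb both the constant and the linear term.\<close>
    define t where "t = 1 + (\<bar>a\<bar> + 2 * \<bar>s\<bar>) / (- b)"
    have t1: "t \<ge> 1" unfolding t_def using b by (simp add: divide_nonneg_neg divide_nonpos_neg divide_le_0_iff)
    have tb: "t * b = b - (\<bar>a\<bar> + 2 * \<bar>s\<bar>)" unfolding t_def using b by (simp add: field_simps)
    have "a + 2 * t * s + t\<^sup>2 * b = a + t * (2 * s + t * b)" by (simp add: algebra_simps power2_eq_square)
    also have "\<dots> \<le> a + t * (b - \<bar>a\<bar>)"
      using t1 tb by (intro add_left_mono mult_left_mono) auto
    also have "\<dots> \<le> a + 1 * (b - \<bar>a\<bar>)"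
      using t1 b by (intro add_left_mono mult_right_mono_neg) auto
    also have "\<dots> < 0" using b by simp
    finally show False using assms[of t] by simp
  qed
  with False have b: "b > 0" by simp
  show ?thesis
    using assms[of "- s / b"] b by (simp add: field_simps power2_eq_square)
qed

lemma LIMSEQ_null_dominated:
  fixes a b :: "nat \<Rightarrow> real"
  assumes "b \<longlonglongrightarrow> 0" "\<And>n. 0 \<le> a n" "\<And>n. a n \<le> b n"
  shows "a \<longlonglongrightarrow> 0"
  by (rule tendsto_sandwich[OF _ _ tendsto_const assms(1)]) (use assms in auto)

lemma smul_apply: "smul c f x = c * f x"
  by (simp add: smul_def)

text \<open>
Vectors are themselves functions.  The pointwise rules must therefore not fire on them during
simplification, but they should fire one level up, where an operator is applied to a vector.
\<close>

lemma operator_apply [simp]: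
  fixes A B :: "('o \<Rightarrow> complex) \<Rightarrow> ('o \<Rightarrow> complex)"
  shows "(A + B) f = A f + B f" "(A - B) f = A f - B f" "(- A) f = - A f"
    "(0 :: ('o \<Rightarrow> complex) \<Rightarrow> ('o \<Rightarrow> complex)) f = 0"
  by (simp_all add: plus_fun_apply minus_apply uminus_apply zero_fun_apply)

declare plus_fun_apply [simp del] zero_fun_apply [simp del] minus_apply [simp del] uminus_apply [simp del]

lemmas pointwise = plus_fun_apply zero_fun_apply minus_apply uminus_apply smul_apply

lemma smul_one [simp]: "smul 1 f = f"
  by (simp add: fun_eq_iff pointwise)

lemma smul_smul [simp]: "smul c (smul d f) = smul (c * d) f"
  by (simp add: fun_eq_iff pointwise)

lemma smul_0 [simp]: "smul 0 f = 0" "smul c 0 = 0"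
  by (simp_all add: fun_eq_iff pointwise)

lemma smul_add: "smul c (f + g) = smul c f + smul c g"
  and smul_add_left: "smul (c + d) f = smul c f + smul d f"
  and smul_diff: "smul c (f - g) = smul c f - smul c g"
  by (simp_all add: fun_eq_iff pointwise algebra_simps)

lemma smul_uminus: "- f = smul (complex_of_real (-1)) f"
  by (simp add: fun_eq_iff pointwise)

context hilbert_function_space
begin

section \<open>Algebra of the inner product\<close>

lemma of_real_scalars [simp]: "complex_of_real c \<in> scalars X"
  using scalars_real_or_complex by (metis Reals_of_real UNIV_I)

lemma zero_one_scalars [simp]: "0 \<in> scalars X" "1 \<in> scalars X" "-1 \<in> scalars X"
  using of_real_scalars[of 0] of_real_scalars[of 1] of_real_scalars[of "-1"] by simp_all

lemma scalars_closed [simp]: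
  assumes "c \<in> scalars X"
  shows "cnj c \<in> scalars X" "- c \<in> scalars X"
    and "d \<in> scalars X \<Longrightarrow> c * d \<in> scalars X"
    and "d \<in> scalars X \<Longrightarrow> c + d \<in> scalars X"
    and "d \<in> scalars X \<Longrightarrow> c - d \<in> scalars X"
    and "d \<in> scalars X \<Longrightarrow> c / d \<in> scalars X"
proof -
  consider "scalars X = \<real>" | "scalars X = UNIV" using scalars_real_or_complex by blast
  then have "cnj c \<in> scalars X \<and> - c \<in> scalars X \<and> (d \<in> scalars X \<longrightarrow>
      c * d \<in> scalars X \<and> c + d \<in> scalars X \<and> c - d \<in> scalars X \<and> c / d \<in> scalars X)"
    using assms by cases (simp_all add: Reals_cnj_iff)
  then show "cnj c \<in> scalars X" "- c \<in> scalars X"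
    and "d \<in> scalars X \<Longrightarrow> c * d \<in> scalars X"
    and "d \<in> scalars X \<Longrightarrow> c + d \<in> scalars X"
    and "d \<in> scalars X \<Longrightarrow> c - d \<in> scalars X"
    and "d \<in> scalars X \<Longrightarrow> c / d \<in> scalars X"
    by auto
qed

lemma vecs_closed [simp]:
  assumes "f \<in> vecs X"
  shows "c \<in> scalars X \<Longrightarrow> smul c f \<in> vecs X"
    and "- f \<in> vecs X"
    and "g \<in> vecs X \<Longrightarrow> f + g \<in> vecs X"
    and "g \<in> vecs X \<Longrightarrow> f - g \<in> vecs X"
proof -
  have neg: "- f \<in> vecs X" if "f \<in> vecs X" for f
    using that by (subst smul_uminus) (rule smul_vecs[OF of_real_scalars])
  from neg[OF assms] show "- f \<in> vecs X" .
  show "f - g \<in> vecs X" if "g \<in> vecs X"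
    using add_vecs[OF assms neg[OF that]] by simp
qed (use assms smul_vecs add_vecs in auto)

declare zero_vecs [simp]

lemma ip_add_right:
  assumes "f \<in> vecs X" "g \<in> vecs X" "h \<in> vecs X"
  shows "ip X f (g + h) = ip X f g + ip X f h"
  using ip_cnj[of "g + h" f] ip_cnj[of g f] ip_cnj[of h f] ip_add[of g h f] assms
  by (simp del: complex_cnj_add add: complex_cnj_add[symmetric])

lemma ip_smul_right:
  assumes "c \<in> scalars X" "f \<in> vecs X" "g \<in> vecs X"
  shows "ip X f (smul c g) = cnj c * ip X f g"
  using ip_cnj[of "smul c g" f] ip_cnj[of g f] ip_smul[of c g f] assms by simp

lemma ip_uminus [simp]:
  assumes "f \<in> vecs X" "g \<in> vecs X"
  shows "ip X (- f) g = - ip X f g" "ip X f (- g) = - ip X f g"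
  using ip_smul[of "complex_of_real (-1)" f g] ip_smul_right[of "complex_of_real (-1)" f g] assms
  by (simp_all add: smul_uminus)

lemma ip_diff:
  assumes "f \<in> vecs X" "g \<in> vecs X" "h \<in> vecs X"
  shows "ip X (f - g) h = ip X f h - ip X g h" "ip X h (f - g) = ip X h f - ip X h g"
  using ip_add[of f "- g" h] ip_add_right[of h f "- g"] assms by simp_all

lemma ip_zero [simp]:
  assumes "f \<in> vecs X"
  shows "ip X 0 f = 0" "ip X f 0 = 0"
  using ip_diff[of f f f] assms by simp_all

lemmas ip_simps = ip_add ip_add_right ip_diff ip_smul ip_smul_right

lemma Re_ip_commute: "f \<in> vecs X \<Longrightarrow> g \<in> vecs X \<Longrightarrow> Re (ip X g f) = Re (ip X f g)"
  by (subst ip_cnj) auto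

lemma nrm_sq: "f \<in> vecs X \<Longrightarrow> (nrm X f)\<^sup>2 = Re (ip X f f)"
  by (simp add: nrm_def ip_nonneg)

lemma ip_self: "f \<in> vecs X \<Longrightarrow> ip X f f = complex_of_real ((nrm X f)\<^sup>2)"
  using ip_cnj[of f f] by (simp add: nrm_sq complex_eq_iff)

lemma nrm_nonneg [simp]: "f \<in> vecs X \<Longrightarrow> 0 \<le> nrm X f"
  by (simp add: nrm_def ip_nonneg)

lemma nrm_zero [simp]: "nrm X 0 = 0"
  by (simp add: nrm_def)

lemma nrm_eq_0_iff: "f \<in> vecs X \<Longrightarrow> nrm X f = 0 \<longleftrightarrow> f = 0"
  using ip_self[of f] ip_definite[of f] by auto

lemma nrm_smul: "c \<in> scalars X \<Longrightarrow> f \<in> vecs X \<Longrightarrow> nrm X (smul c f) = cmod c * nrm X f"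
proof -
  assume c: "c \<in> scalars X" and f: "f \<in> vecs X"
  have "ip X (smul c f) (smul c f) = (c * cnj c) * ip X f f"
    using c f by (simp add: ip_smul ip_smul_right)
  also have "\<dots> = complex_of_real ((cmod c * nrm X f)\<^sup>2)"
    unfolding complex_norm_square[symmetric] ip_self[OF f] by (simp add: power_mult_distrib)
  finally have "(nrm X (smul c f))\<^sup>2 = (cmod c * nrm X f)\<^sup>2"
    using c f by (simp only: nrm_sq vecs_closed Re_complex_of_real)
  then show ?thesis
    by (rule power2_eq_imp_eq) (use c f in simp_all)
qed

text \<open>
The phase lies in the scalar field for real and for complex spaces, so estimates of real parts
extend to moduli without separating the two cases.
\<close>

lemma scalar_phase:
  assumes "z \<in> scalars X"
  obtains c where "c \<in> scalars X" "cmod c = 1" "c * z = complex_of_real (cmod z)"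
proof (cases "z = 0")
  case True
  then show ?thesis using that[of 1] by simp
next
  case False
  let ?c = "cnj z / complex_of_real (cmod z)"
  show ?thesis
  proof (rule that[of ?c])
    show "?c \<in> scalars X" using assms by simp
    show "cmod ?c = 1" using False by (simp add: norm_divide)
    have "z * cnj z = complex_of_real (cmod z) * complex_of_real (cmod z)"
      using complex_norm_square[of z] by (simp add: power2_eq_square)
    then show "?c * z = complex_of_real (cmod z)" using False by (simp add: field_simps)
  qed
qed

section \<open>Bounded operators\<close>

lemma
  assumes "A \<in> bops X"
  shows bops_closed: "f \<in> vecs X \<Longrightarrow> A f \<in> vecs X"
    and bops_outside: "f \<notin> vecs X \<Longrightarrow> A f = 0"
    and bops_add: "f \<in> vecs X \<Longrightarrow> g \<in> vecs X \<Longrightarrow> A (f + g) = A f + A g"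
    and bops_smul: "c \<in> scalars X \<Longrightarrow> f \<in> vecs X \<Longrightarrow> A (smul c f) = smul c (A f)"
    and bops_boundedD: "\<exists>C. \<forall>f\<in>vecs X. nrm X (A f) \<le> C * nrm X f"
proof -
  note * = assms[unfolded bops_def mem_Collect_eq, rule_format]
  show "f \<in> vecs X \<Longrightarrow> A f \<in> vecs X"
    using *[THEN conjunct1, rule_format] .
  show "f \<notin> vecs X \<Longrightarrow> A f = 0"
    using *[THEN conjunct2, THEN conjunct1, rule_format] .
  show "f \<in> vecs X \<Longrightarrow> g \<in> vecs X \<Longrightarrow> A (f + g) = A f + A g"
    using *[THEN conjunct2, THEN conjunct2, THEN conjunct1, rule_format] .
  show "c \<in> scalars X \<Longrightarrow> f \<in> vecs X \<Longrightarrow> A (smul c f) = smul c (A f)"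
    using *[THEN conjunct2, THEN conjunct2, THEN conjunct2, THEN conjunct1, rule_format] .
  show "\<exists>C. \<forall>f\<in>vecs X. nrm X (A f) \<le> C * nrm X f"
    using *[THEN conjunct2, THEN conjunct2, THEN conjunct2, THEN conjunct2] .
qed

lemma bops_zero: "A \<in> bops X \<Longrightarrow> A 0 = 0"
  using bops_smul[of A 0 0] by simp

lemma bops_diff: "A \<in> bops X \<Longrightarrow> f \<in> vecs X \<Longrightarrow> g \<in> vecs X \<Longrightarrow> A (f - g) = A f - A g"
  using bops_add[of A "f - g" g] by (simp add: eq_diff_eq)

text \<open>
The head of the left-hand sides is a variable, which matches every application; these rules are
for simplification only after the operator has been fixed by instantiating the premise.
\<close>

lemmas bops_linear = bops_closed bops_zero bops_add bops_smul bops_diff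

lemma bops_bounded:
  assumes "A \<in> bops X"
  obtains C where "C \<ge> 0" "\<And>f. f \<in> vecs X \<Longrightarrow> nrm X (A f) \<le> C * nrm X f"
proof -
  obtain C where C: "\<forall>f\<in>vecs X. nrm X (A f) \<le> C * nrm X f"
    using assms by (auto simp: bops_def)
  show ?thesis
  proof (rule that[of "max C 0"])
    fix f assume f: "f \<in> vecs X"
    then have "C * nrm X f \<le> max C 0 * nrm X f" by (intro mult_right_mono) auto
    with C f show "nrm X (A f) \<le> max C 0 * nrm X f" by force
  qed simp
qed

lemma bopsI:
  assumes "\<And>f. f \<in> vecs X \<Longrightarrow> A f \<in> vecs X" "\<And>f. f \<notin> vecs X \<Longrightarrow> A f = 0"
    "\<And>f g. f \<in> vecs X \<Longrightarrow> g \<in> vecs X \<Longrightarrow> A (f + g) = A f + A g"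
    "\<And>c f. c \<in> scalars X \<Longrightarrow> f \<in> vecs X \<Longrightarrow> A (smul c f) = smul c (A f)"
    "\<And>f. f \<in> vecs X \<Longrightarrow> nrm X (A f) \<le> C * nrm X f"
  shows "A \<in> bops X"
  using assms unfolding bops_def by (intro CollectI conjI ballI allI impI exI[of _ C])

lemma bops_eqI:
  assumes "A \<in> bops X" "B \<in> bops X" "\<And>f. f \<in> vecs X \<Longrightarrow> A f = B f"
  shows "A = B"
proof (rule ext)
  show "A f = B f" for f
    using assms(3)[of f] bops_outside[OF assms(1), of f] bops_outside[OF assms(2), of f]
    by (cases "f \<in> vecs X") auto
qed

lemma op_id_apply [simp]: "f \<in> vecs X \<Longrightarrow> op_id X f = f"
  by (simp add: op_id_def)

lemma op_id_bops [simp]: "op_id X \<in> bops X"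
  by (rule bopsI[where C = 1]) (auto simp: op_id_def)

definition selfadjoint :: "'o operator \<Rightarrow> bool" where
  "selfadjoint B \<longleftrightarrow> B \<in> bops X \<and> (\<forall>f\<in>vecs X. \<forall>g\<in>vecs X. ip X (B f) g = ip X f (B g))"

definition positive :: "'o operator \<Rightarrow> bool" where
  "positive B \<longleftrightarrow> selfadjoint B \<and> (\<forall>f\<in>vecs X. 0 \<le> Re (ip X (B f) f))"

lemma selfadjoint_bops [simp]: "selfadjoint B \<Longrightarrow> B \<in> bops X"
  and selfadjointD: "selfadjoint B \<Longrightarrow> f \<in> vecs X \<Longrightarrow> g \<in> vecs X \<Longrightarrow> ip X (B f) g = ip X f (B g)"
  by (auto simp: selfadjoint_def)

lemma positive_selfadjoint [simp]: "positive B \<Longrightarrow> selfadjoint B"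
  and positiveD: "positive B \<Longrightarrow> f \<in> vecs X \<Longrightarrow> 0 \<le> Re (ip X (B f) f)"
  by (auto simp: positive_def)

lemma positive_id: "positive (op_id X)"
  by (auto simp: positive_def selfadjoint_def ip_nonneg)

lemma selfadjoint_quadratic:
  assumes B: "selfadjoint B" and f: "f \<in> vecs X" and g: "g \<in> vecs X"
  shows "Re (ip X (B (f + smul (complex_of_real t) g)) (f + smul (complex_of_real t) g)) =
    Re (ip X (B f) f) + 2 * t * Re (ip X (B f) g) + t\<^sup>2 * Re (ip X (B g) g)"
proof -
  note [simp] = bops_linear[OF selfadjoint_bops[OF B]] f g
  have "Re (ip X (B g) f) = Re (ip X (B f) g)"
    using Re_ip_commute[of g "B f"] by (simp add: selfadjointD[OF B])
  then show ?thesis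
    by (simp add: ip_simps power2_eq_square algebra_simps)
qed

text \<open>
The form \<open>\<langle>B f, g\<rangle>\<close> is a semi-inner product.  Rotating \<open>f\<close> by a phase makes \<open>\<langle>B f, g\<rangle>\<close> real and
nonnegative, and then the discriminant of \<open>t \<mapsto> \<langle>B (f + t g), f + t g\<rangle>\<close> gives the bound.
\<close>

lemma positive_cauchy_schwarz:
  assumes B: "positive B" and f: "f \<in> vecs X" and g: "g \<in> vecs X"
  shows "(cmod (ip X (B f) g))\<^sup>2 \<le> Re (ip X (B f) f) * Re (ip X (B g) g)"
proof -
  note [simp] = bops_linear[OF selfadjoint_bops[OF positive_selfadjoint[OF B]]] f g
  obtain c where c: "c \<in> scalars X" "cmod c = 1"
    "c * ip X (B f) g = complex_of_real (cmod (ip X (B f) g))"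
    using scalar_phase[OF ip_scalar[of "B f" g]] by auto
  have cc: "c * cnj c = 1" using complex_norm_square[of c] c(2) by simp
  let ?f = "smul c f"
  have "(Re (ip X (B ?f) g))\<^sup>2 \<le> Re (ip X (B ?f) ?f) * Re (ip X (B g) g)"
  proof (rule quadratic_nonneg_imp)
    fix t
    have "?f \<in> vecs X" "?f + smul (complex_of_real t) g \<in> vecs X"
      using c(1) by simp_all
    then show "0 \<le> Re (ip X (B ?f) ?f) + 2 * t * Re (ip X (B ?f) g) + t\<^sup>2 * Re (ip X (B g) g)"
      using positiveD[OF B, of "?f + smul (complex_of_real t) g"]
        selfadjoint_quadratic[OF positive_selfadjoint[OF B], of ?f g t] g by linarith
  qed
  moreover have "ip X (B ?f) ?f = (c * cnj c) * ip X (B f) f"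
    using c(1) by (simp add: ip_simps mult.assoc)
  moreover have "ip X (B ?f) g = complex_of_real (cmod (ip X (B f) g))"
    using c by (simp add: ip_simps)
  ultimately show ?thesis by (simp add: cc)
qed

lemma cauchy_schwarz:
  assumes f: "f \<in> vecs X" and g: "g \<in> vecs X"
  shows "cmod (ip X f g) \<le> nrm X f * nrm X g"
  using positive_cauchy_schwarz[OF positive_id f g] f g
  by (simp add: nrm_sq[symmetric] power_mult_distrib[symmetric] power2_le_iff_abs_le)

lemma nrm_triangle:
  assumes f: "f \<in> vecs X" and g: "g \<in> vecs X"
  shows "nrm X (f + g) \<le> nrm X f + nrm X g"
proof -
  have "(nrm X (f + g))\<^sup>2 = (nrm X f)\<^sup>2 + 2 * Re (ip X f g) + (nrm X g)\<^sup>2"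
    using f g Re_ip_commute[OF f g] by (simp add: nrm_sq ip_simps)
  also have "\<dots> \<le> (nrm X f + nrm X g)\<^sup>2"
    using cauchy_schwarz[OF f g] complex_Re_le_cmod[of "ip X f g"]
    unfolding power2_sum by linarith
  finally show ?thesis
    by (rule power2_le_imp_le) (use f g in simp)
qed

lemma nrm_uminus [simp]: "f \<in> vecs X \<Longrightarrow> nrm X (- f) = nrm X f"
  by (simp add: nrm_def)

lemma nrm_minus_commute: "f \<in> vecs X \<Longrightarrow> g \<in> vecs X \<Longrightarrow> nrm X (f - g) = nrm X (g - f)"
  using nrm_uminus[of "f - g"] by simp

text \<open>
Buzano's inequality is the Schwarz inequality for \<open>b\<close> and the reflection
\<open>u = 2 \<langle>a, e\<rangle> e - a\<close> of \<open>a\<close> in the line of \<open>e\<close>, which has the same norm as \<open>a\<close>.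
\<close>

lemma buzano:
  assumes a: "a \<in> vecs X" and b: "b \<in> vecs X" and e: "e \<in> vecs X" and e1: "nrm X e = 1"
  shows "cmod (ip X a e) * cmod (ip X e b) \<le> (nrm X a * nrm X b + cmod (ip X a b)) / 2"
proof -
  let ?c = "2 * ip X a e"
  have c: "?c \<in> scalars X"
    using scalars_closed(4)[of "ip X a e" "ip X a e"] ip_scalar[OF a e] by simp
  define u where "u = smul ?c e - a"
  have u: "u \<in> vecs X" using c a e by (simp add: u_def)
  have ee: "ip X e e = 1" using ip_self[OF e] e1 by simp
  have ea: "ip X e a = cnj (ip X a e)" using ip_cnj[OF a e] .
  have "ip X u u = ip X a a"
    using a e c by (simp add: u_def ip_simps ee ea)
  then have nu: "nrm X u = nrm X a" by (simp add: nrm_def)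
  have "ip X u b = 2 * (ip X a e * ip X e b) - ip X a b"
    using a b e c by (simp add: u_def ip_simps)
  then have "2 * (ip X a e * ip X e b) = ip X u b + ip X a b" by simp
  then have "2 * (cmod (ip X a e) * cmod (ip X e b)) = cmod (ip X u b + ip X a b)"
    using norm_mult[of 2 "ip X a e * ip X e b"] by (simp add: norm_mult)
  also have "\<dots> \<le> nrm X u * nrm X b + cmod (ip X a b)"
    using norm_triangle_ineq[of "ip X u b" "ip X a b"] cauchy_schwarz[OF u b] by linarith
  finally show ?thesis using nu by simp
qed

section \<open>Convergence\<close>

definition conv :: "(nat \<Rightarrow> 'o \<Rightarrow> complex) \<Rightarrow> ('o \<Rightarrow> complex) \<Rightarrow> bool" where
  "conv u f \<longleftrightarrow> (\<forall>n. u n \<in> vecs X) \<and> f \<in> vecs X \<and> (\<lambda>n. nrm X (u n - f)) \<longlonglongrightarrow> 0"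

lemma conv_vecs: "conv u f \<Longrightarrow> u n \<in> vecs X" "conv u f \<Longrightarrow> f \<in> vecs X"
  by (auto simp: conv_def)

lemma conv_const: "f \<in> vecs X \<Longrightarrow> conv (\<lambda>_. f) f"
  by (simp add: conv_def)

lemma conv_bounded_op:
  assumes A: "A \<in> bops X" and u: "conv u f"
  shows "conv (\<lambda>n. A (u n)) (A f)"
proof -
  note [simp] = bops_linear[OF A] conv_vecs[OF u]
  obtain C where C: "C \<ge> 0" "\<And>f. f \<in> vecs X \<Longrightarrow> nrm X (A f) \<le> C * nrm X f"
    using bops_bounded[OF A] by metis
  have *: "nrm X (A (u n) - A f) \<le> C * nrm X (u n - f)" for n
    using C(2)[of "u n - f"] by simp
  have lim: "(\<lambda>n. C * nrm X (u n - f)) \<longlonglongrightarrow> 0"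
    using u tendsto_mult_left[of "\<lambda>n. nrm X (u n - f)" 0 sequentially C] by (simp add: conv_def)
  have "(\<lambda>n. nrm X (A (u n) - A f)) \<longlonglongrightarrow> 0"
    by (rule LIMSEQ_null_dominated[OF lim _ *]) simp
  then show ?thesis by (simp add: conv_def)
qed

lemma conv_ip:
  assumes u: "conv u f" and v: "conv v g"
  shows "(\<lambda>n. ip X (u n) (v n)) \<longlonglongrightarrow> ip X f g"
proof -
  note [simp] = conv_vecs[OF u] conv_vecs[OF v]
  have lim: "(\<lambda>n. nrm X (u n - f) * nrm X (v n - g) + nrm X (u n - f) * nrm X g
      + nrm X f * nrm X (v n - g)) \<longlonglongrightarrow> 0 * 0 + 0 * nrm X g + nrm X f * 0"
    using u v unfolding conv_def by (intro tendsto_intros) auto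
  have "norm (ip X (u n) (v n) - ip X f g) \<le> nrm X (u n - f) * nrm X (v n - g)
      + nrm X (u n - f) * nrm X g + nrm X f * nrm X (v n - g)" for n
  proof -
    have "cmod (ip X (u n) (v n) - ip X f g) =
        cmod (ip X (u n - f) (v n - g) + ip X (u n - f) g + ip X f (v n - g))"
      by (simp add: ip_simps algebra_simps)
    also have "\<dots> \<le> cmod (ip X (u n - f) (v n - g)) + cmod (ip X (u n - f) g)
        + cmod (ip X f (v n - g))"
      using norm_triangle_ineq[of "ip X (u n - f) (v n - g) + ip X (u n - f) g" "ip X f (v n - g)"]
        norm_triangle_ineq[of "ip X (u n - f) (v n - g)" "ip X (u n - f) g"] by linarith
    also have "\<dots> \<le> nrm X (u n - f) * nrm X (v n - g)
        + nrm X (u n - f) * nrm X g + nrm X f * nrm X (v n - g)"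
      by (intro add_mono cauchy_schwarz) auto
    finally show ?thesis .
  qed
  then have "(\<lambda>n. ip X (u n) (v n) - ip X f g) \<longlonglongrightarrow> 0"
    using lim by (intro Lim_null_comparison[OF _ lim[simplified]] always_eventually) auto
  then show ?thesis by (simp add: LIM_zero_iff)
qed

lemma ip_eqI:
  assumes "f \<in> vecs X" "g \<in> vecs X" "\<And>h. h \<in> vecs X \<Longrightarrow> ip X f h = ip X g h"
  shows "f = g"
  using ip_definite[of "f - g"] assms by (simp add: ip_simps)

lemma ip_eqI':
  assumes "f \<in> vecs X" "g \<in> vecs X" "\<And>h. h \<in> vecs X \<Longrightarrow> ip X h f = ip X h g"
  shows "f = g"
  using ip_definite[of "f - g"] assms by (simp add: ip_simps)

lemma conv_unique:
  assumes "conv u f" "conv u g"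
  shows "f = g"
proof (rule ip_eqI)
  fix h assume h: "h \<in> vecs X"
  show "ip X f h = ip X g h"
    using LIMSEQ_unique[OF conv_ip[OF assms(1) conv_const[OF h]] conv_ip[OF assms(2) conv_const[OF h]]] .
qed (use assms conv_vecs in auto)

lemma conv_add:
  assumes u: "conv u f" and v: "conv v g"
  shows "conv (\<lambda>n. u n + v n) (f + g)"
proof -
  note [simp] = conv_vecs[OF u] conv_vecs[OF v]
  have lim: "(\<lambda>n. nrm X (u n - f) + nrm X (v n - g)) \<longlonglongrightarrow> 0"
    using u v unfolding conv_def by (auto intro: tendsto_add_zero)
  have *: "nrm X (u n + v n - (f + g)) \<le> nrm X (u n - f) + nrm X (v n - g)" for n
    using nrm_triangle[of "u n - f" "v n - g"] by (simp add: add_diff_add)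
  have "(\<lambda>n. nrm X (u n + v n - (f + g))) \<longlonglongrightarrow> 0"
    by (rule LIMSEQ_null_dominated[OF lim _ *]) simp
  then show ?thesis by (simp add: conv_def)
qed

lemma conv_smul:
  assumes u: "conv u f" and c: "c \<in> scalars X"
  shows "conv (\<lambda>n. smul c (u n)) (smul c f)"
proof -
  note [simp] = conv_vecs[OF u]
  have "nrm X (smul c (u n) - smul c f) = cmod c * nrm X (u n - f)" for n
    using nrm_smul[OF c, of "u n - f"] by (simp add: smul_diff)
  moreover have "(\<lambda>n. cmod c * nrm X (u n - f)) \<longlonglongrightarrow> cmod c * 0"
    using u unfolding conv_def by (intro tendsto_intros) auto
  ultimately have "(\<lambda>n. nrm X (smul c (u n) - smul c f)) \<longlonglongrightarrow> 0" by simp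
  then show ?thesis using c by (simp add: conv_def)
qed

lemma conv_nrm: "conv u f \<Longrightarrow> (\<lambda>n. nrm X (u n)) \<longlonglongrightarrow> nrm X f"
  unfolding nrm_def by (intro tendsto_real_sqrt tendsto_Re conv_ip)

lemma Cauchy_conv:
  assumes "\<And>n. u n \<in> vecs X"
    and "\<And>e. 0 < e \<Longrightarrow> \<exists>N. \<forall>m\<ge>N. \<forall>n\<ge>N. nrm X (u m - u n) < e"
  obtains f where "conv u f"
proof -
  obtain f where "f \<in> vecs X" "(\<lambda>n. nrm X (u n - f)) \<longlonglongrightarrow> 0"
    using complete[of u, OF assms] by blast
  then show ?thesis using that assms(1) unfolding conv_def by blast
qed

end

context hilbert_function_space
begin

section \<open>Coercive operators, adjoints and the spectrum of a positive operator\<close>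

text \<open>
The solution minimises the energy \<open>J f = Re \<langle>B f, f\<rangle> - 2 Re (\<phi> f)\<close>.  Coercivity bounds \<open>J\<close> from
below and, through the parallelogram identity for \<open>J\<close>, makes every minimising sequence a Cauchy
sequence; the limit solves the equation because \<open>J\<close> has no descent direction there.
Riesz representation is the case of the identity, and the invertibility of coercive operators is the
case of the functionals \<open>\<langle>\<cdot>, h\<rangle>\<close>.
\<close>

lemma lax_milgram_selfadjoint:
  assumes B: "selfadjoint B" and c: "0 < c"
    and coercive: "\<And>f. f \<in> vecs X \<Longrightarrow> c * (nrm X f)\<^sup>2 \<le> Re (ip X (B f) f)"
    and phi_scalar: "\<And>f. f \<in> vecs X \<Longrightarrow> \<phi> f \<in> scalars X"
    and phi_add: "\<And>f g. f \<in> vecs X \<Longrightarrow> g \<in> vecs X \<Longrightarrow> \<phi> (f + g) = \<phi> f + \<phi> g"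
    and phi_smul: "\<And>a f. a \<in> scalars X \<Longrightarrow> f \<in> vecs X \<Longrightarrow> \<phi> (smul a f) = a * \<phi> f"
    and phi_bounded: "\<And>f. f \<in> vecs X \<Longrightarrow> cmod (\<phi> f) \<le> C * nrm X f"
  obtains g where "g \<in> vecs X" "\<And>f. f \<in> vecs X \<Longrightarrow> \<phi> f = ip X f (B g)"
proof -
  note [simp] = bops_linear[OF selfadjoint_bops[OF B]]
  define J where "J f = Re (ip X (B f) f) - 2 * Re (\<phi> f)" for f
  have J_line: "J (f + smul (complex_of_real t) h) =
      J f + 2 * t * (Re (ip X (B f) h) - Re (\<phi> h)) + t\<^sup>2 * Re (ip X (B h) h)"
    if "f \<in> vecs X" "h \<in> vecs X" for f h t
    using that unfolding J_def selfadjoint_quadratic[OF B that] by (simp add: phi_add phi_smul algebra_simps)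
  have J_bounded: "- (C\<^sup>2 / c) \<le> J f" if f: "f \<in> vecs X" for f
  proof -
    have "0 \<le> (c * nrm X f - C)\<^sup>2 / c" using c by simp
    also have "\<dots> = c * (nrm X f)\<^sup>2 - 2 * (C * nrm X f) + C\<^sup>2 / c"
      using c by (simp add: field_simps power2_eq_square)
    also have "\<dots> \<le> J f + C\<^sup>2 / c"
      using coercive[OF f] phi_bounded[OF f] complex_Re_le_cmod[of "\<phi> f"]
      unfolding J_def by linarith
    finally show ?thesis by simp
  qed
  define m where "m = Inf (J ` vecs X)"
  have m_le: "m \<le> J f" if "f \<in> vecs X" for f
    unfolding m_def by (rule cInf_lower) (use that J_bounded in \<open>auto simp: bdd_below_def\<close>)
  have "\<exists>f\<in>vecs X. J f < m + 1 / real (Suc n)" for n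
  proof -
    have "\<exists>x\<in>J ` vecs X. x < m + 1 / real (Suc n)"
      by (rule cInf_lessD) (use zero_vecs in \<open>auto simp: m_def simp del: zero_vecs\<close>)
    then show ?thesis by auto
  qed
  then obtain u where u: "\<And>n. u n \<in> vecs X" "\<And>n. J (u n) < m + 1 / real (Suc n)"
    by metis
  note [simp] = u(1)
  have close: "c * (nrm X (a - b))\<^sup>2 \<le> 2 * ((J a - m) + (J b - m))"
    if a: "a \<in> vecs X" and b: "b \<in> vecs X" for a b
  proof -
    have "J a = J b + 2 * (Re (ip X (B b) (a - b)) - Re (\<phi> (a - b))) + Re (ip X (B (a - b)) (a - b))"
      using J_line[of b "a - b" 1] a b by simp
    moreover have "m \<le> J b + (Re (ip X (B b) (a - b)) - Re (\<phi> (a - b)))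
        + Re (ip X (B (a - b)) (a - b)) / 4"
    proof -
      \<comment> \<open>The midpoint of \<open>a\<close> and \<open>b\<close>, whose energy is at least the infimum \<open>m\<close>.\<close>
      define w where "w = b + smul (complex_of_real (1/2)) (a - b)"
      have "w \<in> vecs X" unfolding w_def using a b by (intro vecs_closed of_real_scalars)
      moreover have "J w = J b + (Re (ip X (B b) (a - b)) - Re (\<phi> (a - b)))
          + Re (ip X (B (a - b)) (a - b)) / 4"
        using J_line[of b "a - b" "1/2", folded w_def] a b by (simp add: power2_eq_square)
      ultimately show ?thesis using m_le by metis
    qed
    ultimately show ?thesis
      using coercive[of "a - b"] a b by (simp del: bops_diff)
  qed
  have "\<exists>N. \<forall>k\<ge>N. \<forall>n\<ge>N. nrm X (u k - u n) < e" if e: "0 < e" for e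
  proof -
    obtain N where N: "4 / (c * e\<^sup>2) < real N" using reals_Archimedean2 by blast
    have "nrm X (u k - u n) < e" if "k \<ge> N" "n \<ge> N" for k n
    proof (rule power2_less_imp_less)
      have small: "J (u i) - m < 1 / real (Suc N)" if "i \<ge> N" for i
      proof -
        have "1 / real (Suc i) \<le> 1 / real (Suc N)" using that by (simp add: frac_le)
        then show ?thesis using u(2)[of i] by linarith
      qed
      have "c * (nrm X (u k - u n))\<^sup>2 < 4 / real (Suc N)"
        using close[of "u k" "u n"] small[OF that(1)] small[OF that(2)] by simp
      also have "4 / real (Suc N) < c * e\<^sup>2"
      proof -
        have pos: "0 < c * e\<^sup>2" using c e by simp
        then have "4 < real N * (c * e\<^sup>2)" using N by (simp add: pos_divide_less_eq)
        then have "4 < real (Suc N) * (c * e\<^sup>2)" using pos by (simp add: distrib_right)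
        then show ?thesis by (simp add: pos_divide_less_eq mult.commute)
      qed
      finally show "(nrm X (u k - u n))\<^sup>2 < e\<^sup>2" using c by simp
    qed (use e in simp)
    then show ?thesis by blast
  qed
  then obtain g where g: "conv u g" using Cauchy_conv[of u] u(1) by metis
  note [simp] = conv_vecs(2)[OF g]
  have Re_eq: "Re (\<phi> h) = Re (ip X h (B g))" if h: "h \<in> vecs X" for h
  proof -
    \<comment> \<open>The variation is computed along the sequence, with error \<open>1 / Suc n\<close>, where each
      term converges because it is linear in the moving vector.\<close>
    have nonneg: "0 \<le> 0 + 2 * t * (Re (ip X g (B h)) - Re (\<phi> h)) + t\<^sup>2 * Re (ip X (B h) h)" for t
    proof (rule LIMSEQ_le_const)
      show "(\<lambda>n. 1 / real (Suc n) + 2 * t * (Re (ip X (u n) (B h)) - Re (\<phi> h)) + t\<^sup>2 * Re (ip X (B h) h))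
          \<longlonglongrightarrow> 0 + 2 * t * (Re (ip X g (B h)) - Re (\<phi> h)) + t\<^sup>2 * Re (ip X (B h) h)"
        using conv_ip[OF g conv_const[of "B h"]] h
        by (intro tendsto_intros lim_1_over_n[THEN LIMSEQ_Suc]) auto
      show "\<exists>N. \<forall>n\<ge>N. 0 \<le> 1 / real (Suc n) + 2 * t * (Re (ip X (u n) (B h)) - Re (\<phi> h))
          + t\<^sup>2 * Re (ip X (B h) h)"
      proof (intro exI allI impI)
        fix n
        have "ip X (B (u n)) h = ip X (u n) (B h)" using h by (simp add: selfadjointD[OF B])
        then show "0 \<le> 1 / real (Suc n) + 2 * t * (Re (ip X (u n) (B h)) - Re (\<phi> h))
          + t\<^sup>2 * Re (ip X (B h) h)"
          using J_line[of "u n" h t] m_le[of "u n + smul (complex_of_real t) h"] u(2)[of n] h by simp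
      qed
    qed
    have "(Re (ip X g (B h)) - Re (\<phi> h))\<^sup>2 \<le> 0 * Re (ip X (B h) h)"
      by (rule quadratic_nonneg_imp) (use nonneg in simp)
    then have "Re (\<phi> h) = Re (ip X g (B h))" by simp
    also have "\<dots> = Re (ip X (B g) h)" using h by (simp add: selfadjointD[OF B])
    also have "\<dots> = Re (ip X h (B g))" using h by (simp add: Re_ip_commute)
    finally show ?thesis .
  qed
  have "\<phi> h = ip X h (B g)" if h: "h \<in> vecs X" for h
  proof -
    \<comment> \<open>Testing with \<open>cnj z\<close> times \<open>h\<close> turns equality of real parts into \<open>|z|\<^sup>2 = 0\<close>; this scalar is available
      over either field.\<close>
    define z where "z = \<phi> h - ip X h (B g)"
    have z: "z \<in> scalars X" using h by (simp add: z_def phi_scalar ip_scalar)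
    have "Re (cnj z * \<phi> h) = Re (cnj z * ip X h (B g))"
      using Re_eq[of "smul (cnj z) h"] h z by (simp add: phi_smul ip_smul)
    moreover have "Re (cnj z * z) = Re (cnj z * \<phi> h) - Re (cnj z * ip X h (B g))"
      by (simp add: z_def algebra_simps)
    ultimately have "Re (cnj z * z) = 0" by simp
    then have "z = 0" by (simp add: complex_eq_iff sum_squares_eq_zero_iff)
    then show ?thesis by (simp add: z_def)
  qed
  then show ?thesis using that[of g] by simp
qed

lemma riesz_representation:
  assumes "\<And>f. f \<in> vecs X \<Longrightarrow> \<phi> f \<in> scalars X"
    and "\<And>f g. f \<in> vecs X \<Longrightarrow> g \<in> vecs X \<Longrightarrow> \<phi> (f + g) = \<phi> f + \<phi> g"
    and "\<And>a f. a \<in> scalars X \<Longrightarrow> f \<in> vecs X \<Longrightarrow> \<phi> (smul a f) = a * \<phi> f"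
    and "\<And>f. f \<in> vecs X \<Longrightarrow> cmod (\<phi> f) \<le> C * nrm X f"
  obtains g where "g \<in> vecs X" "\<And>f. f \<in> vecs X \<Longrightarrow> \<phi> f = ip X f g"
proof -
  have co: "1 * (nrm X f)\<^sup>2 \<le> Re (ip X (op_id X f) f)" if "f \<in> vecs X" for f
    using that by (simp add: nrm_sq)
  obtain g where "g \<in> vecs X" "\<And>f. f \<in> vecs X \<Longrightarrow> \<phi> f = ip X f (op_id X g)"
    by (rule lax_milgram_selfadjoint[OF positive_selfadjoint[OF positive_id] zero_less_one co assms])
      (assumption | blast)+
  then show ?thesis using that[of g] by simp
qed

text \<open>
This is the uniqueness and existence that the definite description in the definition of the adjoint
requires.  Existence comes from representing the functional \<open>f \<mapsto> \<langle>A f, g\<rangle>\<close> for each \<open>g\<close>.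
\<close>

lemma adj_exists:
  assumes A: "A \<in> bops X"
  shows "\<exists>!B. B \<in> bops X \<and> (\<forall>f\<in>vecs X. \<forall>g\<in>vecs X. ip X (A f) g = ip X f (B g))"
proof -
  note [simp] = bops_linear[OF A]
  obtain C where C: "C \<ge> 0" "\<And>f. f \<in> vecs X \<Longrightarrow> nrm X (A f) \<le> C * nrm X f"
    using bops_bounded[OF A] by metis
  have "\<exists>h. h \<in> vecs X \<and> (\<forall>f\<in>vecs X. ip X (A f) g = ip X f h)" if g: "g \<in> vecs X" for g
  proof -
    have bd: "cmod (ip X (A f) g) \<le> (C * nrm X g) * nrm X f" if f: "f \<in> vecs X" for f
    proof -
      have "cmod (ip X (A f) g) \<le> nrm X (A f) * nrm X g" using f g by (simp add: cauchy_schwarz)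
      also have "\<dots> \<le> (C * nrm X f) * nrm X g" using C(2)[OF f] g by (intro mult_right_mono) auto
      finally show ?thesis by (simp add: mult_ac)
    qed
    show ?thesis
      by (rule riesz_representation[of "\<lambda>f. ip X (A f) g", OF _ _ _ bd])
        (use g in \<open>auto simp: ip_scalar ip_simps\<close>)
  qed
  then obtain B0 where B0: "\<And>g. g \<in> vecs X \<Longrightarrow> B0 g \<in> vecs X"
    "\<And>f g. f \<in> vecs X \<Longrightarrow> g \<in> vecs X \<Longrightarrow> ip X (A f) g = ip X f (B0 g)"
    by metis
  define B where "B g = (if g \<in> vecs X then B0 g else 0)" for g
  have Bv: "B g \<in> vecs X" for g using B0 by (simp add: B_def)
  have Bip: "ip X (A f) g = ip X f (B g)" if "f \<in> vecs X" "g \<in> vecs X" for f g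
    using that B0 by (simp add: B_def)
  have "B \<in> bops X"
  proof (rule bopsI)
    show "B (f + g) = B f + B g" if "f \<in> vecs X" "g \<in> vecs X" for f g
      by (rule ip_eqI') (use that Bv in \<open>simp_all add: Bip[symmetric] ip_simps\<close>)
    show "B (smul c f) = smul c (B f)" if "c \<in> scalars X" "f \<in> vecs X" for c f
      by (rule ip_eqI') (use that Bv in \<open>simp_all add: Bip[symmetric] ip_simps\<close>)
    show "nrm X (B g) \<le> C * nrm X g" if g: "g \<in> vecs X" for g
    proof (cases "nrm X (B g) = 0")
      case True
      then show ?thesis using C(1) g by simp
    next
      case False
      have "nrm X (B g) * nrm X (B g) = Re (ip X (A (B g)) g)"
        using Bv g by (simp add: Bip nrm_sq[symmetric] power2_eq_square)
      also have "\<dots> \<le> nrm X (A (B g)) * nrm X g"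
        using complex_Re_le_cmod cauchy_schwarz[of "A (B g)" g] Bv g by (meson order_trans bops_closed A)
      also have "\<dots> \<le> (C * nrm X (B g)) * nrm X g"
        using C(2)[of "B g"] Bv g by (intro mult_right_mono) auto
      finally have "nrm X (B g) * nrm X (B g) \<le> nrm X (B g) * (C * nrm X g)" by (simp add: mult_ac)
      moreover have "0 < nrm X (B g)" using False nrm_nonneg[OF Bv[of g]] by linarith
      ultimately show ?thesis by (rule mult_left_le_imp_le)
    qed
  qed (use Bv B0 in \<open>auto simp: B_def\<close>)
  moreover have "B' = B''" if "B' \<in> bops X" "B'' \<in> bops X"
    "\<forall>f\<in>vecs X. \<forall>g\<in>vecs X. ip X (A f) g = ip X f (B' g)"
    "\<forall>f\<in>vecs X. \<forall>g\<in>vecs X. ip X (A f) g = ip X f (B'' g)" for B' B''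
  proof (rule bops_eqI[OF that(1,2)])
    fix g assume g: "g \<in> vecs X"
    show "B' g = B'' g"
    proof (rule ip_eqI')
      show "ip X h (B' g) = ip X h (B'' g)" if "h \<in> vecs X" for h
        using \<open>\<forall>f\<in>vecs X. \<forall>g\<in>vecs X. ip X (A f) g = ip X f (B' g)\<close>
          \<open>\<forall>f\<in>vecs X. \<forall>g\<in>vecs X. ip X (A f) g = ip X f (B'' g)\<close> that g by metis
    qed (rule bops_closed[OF that(1) g], rule bops_closed[OF that(2) g])
  qed
  ultimately show ?thesis using Bip by (intro ex_ex1I exI[of _ B]) blast+
qed

lemma adj_bops [simp]: "A \<in> bops X \<Longrightarrow> adj X A \<in> bops X"
  and adjD: "A \<in> bops X \<Longrightarrow> f \<in> vecs X \<Longrightarrow> g \<in> vecs X \<Longrightarrow> ip X (A f) g = ip X f (adj X A g)"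
  using theI'[OF adj_exists[of A]] unfolding adj_def[symmetric] by blast+

lemma adj_adj:
  assumes A: "A \<in> bops X"
  shows "adj X (adj X A) = A"
proof (rule bops_eqI)
  note [simp] = bops_closed[OF A] bops_closed[OF adj_bops[OF A]]
    bops_closed[OF adj_bops[OF adj_bops[OF A]]]
  fix f assume f: "f \<in> vecs X"
  show "adj X (adj X A) f = A f"
  proof (rule ip_eqI')
    fix h assume h: "h \<in> vecs X"
    have "ip X h (adj X (adj X A) f) = ip X (adj X A h) f" using A f h by (simp add: adjD)
    also have "\<dots> = cnj (ip X f (adj X A h))" using f h by (subst ip_cnj) auto
    also have "\<dots> = cnj (ip X (A f) h)" using f h by (simp add: adjD[OF A])
    also have "\<dots> = ip X h (A f)" using f h by (subst ip_cnj[of "A f" h]) auto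
    finally show "ip X h (adj X (adj X A) f) = ip X h (A f)" .
  qed (use f in simp_all)
qed (use A in simp_all)

lemma bops_compose [simp]:
  assumes A: "A \<in> bops X" and B: "B \<in> bops X"
  shows "A \<circ> B \<in> bops X"
proof -
  note [simp] = bops_linear[OF A] bops_linear[OF B]
  obtain C where C: "C \<ge> 0" "\<And>f. f \<in> vecs X \<Longrightarrow> nrm X (A f) \<le> C * nrm X f"
    using bops_bounded[OF A] by metis
  obtain D where D: "D \<ge> 0" "\<And>f. f \<in> vecs X \<Longrightarrow> nrm X (B f) \<le> D * nrm X f"
    using bops_bounded[OF B] by metis
  show ?thesis
  proof (rule bopsI[where C = "C * D"])
    show "nrm X ((A \<circ> B) f) \<le> C * D * nrm X f" if f: "f \<in> vecs X" for f
      using C(2)[of "B f"] mult_left_mono[OF D(2)[OF f] C(1)] f by simp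
  qed (use bops_outside[OF B] in simp_all)
qed

lemma bops_plus_op [simp]:
  assumes A: "A \<in> bops X" and B: "B \<in> bops X"
  shows "A + B \<in> bops X"
proof -
  note [simp] = bops_linear[OF A] bops_linear[OF B]
  obtain C where C: "C \<ge> 0" "\<And>f. f \<in> vecs X \<Longrightarrow> nrm X (A f) \<le> C * nrm X f"
    using bops_bounded[OF A] by metis
  obtain D where D: "D \<ge> 0" "\<And>f. f \<in> vecs X \<Longrightarrow> nrm X (B f) \<le> D * nrm X f"
    using bops_bounded[OF B] by metis
  show ?thesis
  proof (rule bopsI[where C = "C + D"])
    show "nrm X ((A + B) f) \<le> (C + D) * nrm X f" if f: "f \<in> vecs X" for f
      using nrm_triangle[of "A f" "B f"] C(2)[OF f] D(2)[OF f] f by (simp add: distrib_right)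
  qed (use bops_outside[OF B] bops_outside[OF A] in \<open>simp_all add: smul_add add_ac\<close>)
qed

lemma bops_op_scale [simp]:
  assumes A: "A \<in> bops X" and a: "a \<in> scalars X"
  shows "op_scale a A \<in> bops X"
proof -
  note [simp] = bops_linear[OF A]
  obtain C where C: "C \<ge> 0" "\<And>f. f \<in> vecs X \<Longrightarrow> nrm X (A f) \<le> C * nrm X f"
    using bops_bounded[OF A] by metis
  show ?thesis
  proof (rule bopsI[where C = "cmod a * C"])
    show "nrm X (op_scale a A f) \<le> cmod a * C * nrm X f" if f: "f \<in> vecs X" for f
      using mult_left_mono[OF C(2)[OF f], of "cmod a"] f a by (simp add: op_scale_def nrm_smul mult_ac)
  qed (use bops_outside[OF A] a in \<open>simp_all add: op_scale_def smul_add mult_ac\<close>)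
qed

lemma bops_minus_op [simp]:
  assumes "A \<in> bops X" "B \<in> bops X"
  shows "A - B \<in> bops X"
proof -
  have "A - B = A + op_scale (complex_of_real (-1)) B"
    by (simp add: fun_eq_iff pointwise op_scale_def)
  moreover have "A + op_scale (complex_of_real (-1)) B \<in> bops X"
    by (rule bops_plus_op[OF assms(1) bops_op_scale[OF assms(2) of_real_scalars]])
  ultimately show ?thesis by (simp only:)
qed

lemma bops_zero_op [simp]: "0 \<in> bops X"
  using bops_minus_op[of "op_id X" "op_id X"] by simp

lemma bops_sum [simp]: "(\<And>i. i \<in> I \<Longrightarrow> A i \<in> bops X) \<Longrightarrow> (\<Sum>i\<in>I. A i) \<in> bops X"
  by (induction I rule: infinite_finite_induct) auto

lemma positive_adj_compose:
  assumes A: "A \<in> bops X"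
  shows "positive (adj X A \<circ> A)"
proof -
  note [simp] = bops_closed[OF A] bops_closed[OF adj_bops[OF A]]
  have eq: "ip X (adj X A (A f)) g = ip X (A f) (A g)" if "f \<in> vecs X" "g \<in> vecs X" for f g
    using adjD[OF adj_bops[OF A], of "A f" g] that by (simp add: adj_adj[OF A])
  have "ip X (adj X A (A f)) g = ip X f (adj X A (A g))" if "f \<in> vecs X" "g \<in> vecs X" for f g
    using that by (simp add: eq adjD[OF A])
  moreover have "0 \<le> Re (ip X (adj X A (A f)) f)" if "f \<in> vecs X" for f
    using that by (simp add: eq ip_nonneg)
  ultimately show ?thesis
    unfolding positive_def selfadjoint_def using A by simp
qed

text \<open>
The sign \<open>s\<close> covers both ends of the spectrum at once: \<open>A - t\<close> is positive definite for \<open>t\<close> below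
the numerical range of \<open>A\<close> and negative definite for \<open>t\<close> above it.
\<close>

lemma invertible_of_coercive:
  assumes D: "selfadjoint D" and c: "0 < c" and s: "s = 1 \<or> s = -1"
    and coercive: "\<And>f. f \<in> vecs X \<Longrightarrow> c * (nrm X f)\<^sup>2 \<le> s * Re (ip X (D f) f)"
  shows "\<exists>R\<in>bops X. R \<circ> D = op_id X \<and> D \<circ> R = op_id X"
proof -
  note Db = selfadjoint_bops[OF D]
  note [simp] = bops_linear[OF Db]
  let ?s = "complex_of_real s"
  have "selfadjoint (op_scale ?s D)"
    unfolding selfadjoint_def
  proof (intro conjI ballI)
    fix f g assume "f \<in> vecs X" "g \<in> vecs X"
    then show "ip X (op_scale ?s D f) g = ip X f (op_scale ?s D g)"
      by (simp add: op_scale_def ip_simps selfadjointD[OF D])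
  qed (use Db in simp)
  moreover have "c * (nrm X f)\<^sup>2 \<le> Re (ip X (op_scale ?s D f) f)" if "f \<in> vecs X" for f
    using coercive[OF that] that by (simp add: op_scale_def ip_simps)
  ultimately have surj: "\<exists>g\<in>vecs X. D g = h" if h: "h \<in> vecs X" for h
  proof (rule lax_milgram_selfadjoint[where \<phi> = "\<lambda>f. ip X f h" and C = "nrm X h", OF _ c])
    fix g assume g: "g \<in> vecs X" "\<And>f. f \<in> vecs X \<Longrightarrow> ip X f h = ip X f (op_scale ?s D g)"
    have "h = op_scale ?s D g" by (rule ip_eqI') (use g h in \<open>auto simp: op_scale_def\<close>)
    then have "D (smul ?s g) = h" using g by (simp add: op_scale_def)
    then show ?thesis using g(1) by (intro bexI[of _ "smul ?s g"]) auto
  qed (use h cauchy_schwarz in \<open>auto simp: ip_scalar ip_simps mult.commute\<close>)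
  have below: "c * nrm X f \<le> nrm X (D f)" if f: "f \<in> vecs X" for f
  proof (cases "nrm X f = 0")
    case False
    have "s * Re (ip X (D f) f) \<le> \<bar>Re (ip X (D f) f)\<bar>" using s by auto
    also have "\<dots> \<le> cmod (ip X (D f) f)" by (rule abs_Re_le_cmod)
    also have "\<dots> \<le> nrm X (D f) * nrm X f" using f by (simp add: cauchy_schwarz)
    finally have "(c * nrm X f) * nrm X f \<le> nrm X (D f) * nrm X f"
      using coercive[OF f] by (simp add: power2_eq_square mult.assoc)
    then show ?thesis using False f nrm_nonneg[OF f] by (simp add: mult_le_cancel_right)
  qed (use f in simp)
  have inj: "f = g" if "f \<in> vecs X" "g \<in> vecs X" "D f = D g" for f g
  proof -
    have "nrm X (f - g) = 0"
      using below[of "f - g"] that c by (intro antisym) (simp_all add: mult_le_0_iff)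
    then show ?thesis using nrm_eq_0_iff[of "f - g"] that by simp
  qed
  from surj obtain R0 where R0: "\<And>h. h \<in> vecs X \<Longrightarrow> R0 h \<in> vecs X" "\<And>h. h \<in> vecs X \<Longrightarrow> D (R0 h) = h"
    by metis
  define R where "R h = (if h \<in> vecs X then R0 h else 0)" for h
  have Rv [simp]: "R h \<in> vecs X" for h using R0 by (simp add: R_def)
  have DR [simp]: "D (R h) = h" if "h \<in> vecs X" for h using that R0 by (simp add: R_def)
  have "R \<in> bops X"
  proof (rule bopsI)
    show "R (f + g) = R f + R g" if "f \<in> vecs X" "g \<in> vecs X" for f g
      by (rule inj) (use that in simp_all)
    show "R (smul a f) = smul a (R f)" if "a \<in> scalars X" "f \<in> vecs X" for a f
      by (rule inj) (use that in simp_all)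
    show "nrm X (R f) \<le> (1 / c) * nrm X f" if "f \<in> vecs X" for f
      using below[of "R f"] that c by (simp add: field_simps)
  qed (use R0 in \<open>auto simp: R_def\<close>)
  moreover have "R (D f) = f" if "f \<in> vecs X" for f
    by (rule inj) (use that in simp_all)
  then have "R \<circ> D = op_id X"
    by (intro ext) (simp add: op_id_def bops_outside[OF Db] bops_zero[OF \<open>R \<in> bops X\<close>])
  moreover have "D \<circ> R = op_id X"
    by (intro ext) (simp add: op_id_def bops_outside[OF \<open>R \<in> bops X\<close>])
  ultimately show ?thesis by blast
qed

lemma selfadjoint_shift:
  assumes A: "selfadjoint A"
  shows "selfadjoint (A - op_scale (complex_of_real t) (op_id X))"
proof -
  note [simp] = bops_closed[OF selfadjoint_bops[OF A]]
  show ?thesis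
    unfolding selfadjoint_def using A
    by (intro conjI ballI bops_minus_op bops_op_scale) (simp_all add: op_scale_def ip_simps selfadjointD)
qed

lemma spectrum_positive:
  assumes A: "positive A"
    and M: "\<And>f. f \<in> vecs X \<Longrightarrow> Re (ip X (A f) f) \<le> M * (nrm X f)\<^sup>2"
    and t: "complex_of_real t \<in> op_spectrum X A"
  shows "0 \<le> t \<and> t \<le> M"
proof (rule ccontr)
  let ?D = "A - op_scale (complex_of_real t) (op_id X)"
  note [simp] = bops_closed[OF selfadjoint_bops[OF positive_selfadjoint[OF A]]]
  have D: "Re (ip X (?D f) f) = Re (ip X (A f) f) - t * (nrm X f)\<^sup>2" if "f \<in> vecs X" for f
    using that by (simp add: op_scale_def ip_simps nrm_sq)
  assume "\<not> (0 \<le> t \<and> t \<le> M)"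
  then consider "t < 0" | "M < t" by linarith
  then have "\<exists>R\<in>bops X. R \<circ> ?D = op_id X \<and> ?D \<circ> R = op_id X"
  proof cases
    case 1
    show ?thesis
    proof (rule invertible_of_coercive[where c = "- t" and s = 1])
      fix f assume f: "f \<in> vecs X"
      show "- t * (nrm X f)\<^sup>2 \<le> 1 * Re (ip X (?D f) f)"
        unfolding D[OF f] using positiveD[OF A f] by simp
    qed (use 1 A selfadjoint_shift in auto)
  next
    case 2
    show ?thesis
    proof (rule invertible_of_coercive[where c = "t - M" and s = "-1"])
      fix f assume f: "f \<in> vecs X"
      show "(t - M) * (nrm X f)\<^sup>2 \<le> -1 * Re (ip X (?D f) f)"
        unfolding D[OF f] using M[OF f] by (simp add: algebra_simps)
    qed (use 2 A selfadjoint_shift in auto)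
  qed
  then show False using t by (auto simp: op_spectrum_def)
qed

text \<open>
This is how the spectrum enters the factorisation of polynomials: off the spectrum the linear
factors are bounded below, with the norm of the inverse giving the constant.
\<close>

lemma bounded_below_off_spectrum:
  assumes A: "A \<in> bops X" and t: "complex_of_real t \<notin> op_spectrum X A"
  obtains c where "0 < c"
    "\<And>f. f \<in> vecs X \<Longrightarrow> c * nrm X f \<le> nrm X (A f - smul (complex_of_real t) f)"
proof -
  let ?D = "A - op_scale (complex_of_real t) (op_id X)"
  note [simp] = bops_closed[OF A]
  obtain R where R: "R \<in> bops X" "R \<circ> ?D = op_id X"
    using t unfolding op_spectrum_def by auto
  obtain C where C: "C \<ge> 0" "\<And>f. f \<in> vecs X \<Longrightarrow> nrm X (R f) \<le> C * nrm X f"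
    using bops_bounded[OF R(1)] by metis
  show ?thesis
  proof (rule that[of "1 / (C + 1)"])
    fix f assume f: "f \<in> vecs X"
    let ?g = "A f - smul (complex_of_real t) f"
    have "R ?g = f" using fun_cong[OF R(2), of f] f by (simp add: op_scale_def)
    then have "nrm X f \<le> C * nrm X ?g" using C(2)[of ?g] f by simp
    also have "\<dots> \<le> (C + 1) * nrm X ?g" using f by (intro mult_right_mono) auto
    finally show "1 / (C + 1) * nrm X f \<le> nrm X ?g" using C(1) by (simp add: field_simps)
  qed (use C in simp)
qed

end

context rkhs
begin

text \<open>
Riesz representation of the evaluation functional shows that the definite description of the kernel
denotes a vector of the space.
\<close>

lemma kernel_vecs [simp]:
  assumes x: "x \<in> points X"
  shows "kernel X x \<in> vecs X"
proof -
  obtain C where C: "\<And>f. f \<in> vecs X \<Longrightarrow> cmod (f x) \<le> C * nrm X f"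
    using eval_bounded[OF x] by blast
  obtain k where k: "k \<in> vecs X" "\<And>f. f \<in> vecs X \<Longrightarrow> f x = ip X f k"
    by (rule riesz_representation[of "\<lambda>f. f x", OF _ _ _ C]) (auto simp: vecs_values pointwise)
  have "\<exists>!k. k \<in> vecs X \<and> (\<forall>f\<in>vecs X. f x = ip X f k)"
  proof (rule ex1I[of _ k])
    fix k' assume k': "k' \<in> vecs X \<and> (\<forall>f\<in>vecs X. f x = ip X f k')"
    show "k' = k" by (rule ip_eqI') (use k k' in auto)
  qed (use k in auto)
  from theI'[OF this] show ?thesis unfolding kernel_def by blast
qed

lemma nkernel_vecs [simp]: "x \<in> points X \<Longrightarrow> nkernel X x \<in> vecs X"
  by (simp add: nkernel_def del: of_real_divide)

lemma nrm_nkernel [simp]: "x \<in> points X \<Longrightarrow> nrm X (nkernel X x) = 1"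
  using nrm_eq_0_iff[of "kernel X x"] kernel_nonzero[of x] nrm_nonneg[of "kernel X x"]
  by (simp add: nkernel_def nrm_smul del: of_real_divide)

end

section \<open>Real polynomials of a self-adjoint operator\<close>

lemma poly_map_of_real_add:
  "poly (map_poly complex_of_real (p + q)) z =
    poly (map_poly complex_of_real p) z + poly (map_poly complex_of_real q) z"
proof -
  have "map_poly complex_of_real (p + q) = map_poly complex_of_real p + map_poly complex_of_real q"
    by (rule poly_eqI) (simp add: coeff_map_poly)
  then show ?thesis by simp
qed

lemma poly_map_of_real_mult:
  "poly (map_poly complex_of_real (p * q)) z =
    poly (map_poly complex_of_real p) z * poly (map_poly complex_of_real q) z"
proof (induction p)
  case (pCons a p)
  have "map_poly complex_of_real (smult a q) = smult (complex_of_real a) (map_poly complex_of_real q)"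
    by (rule poly_eqI) (simp add: coeff_map_poly)
  then show ?case
    using pCons by (simp add: poly_map_of_real_add map_poly_pCons algebra_simps)
qed simp

text \<open>
A complex root \<open>a + i b\<close> of \<open>q\<close> is either real, or its minimal polynomial
\<open>(t - a)\<^sup>2 + b\<^sup>2\<close> over the reals divides \<open>q\<close>: the remainder has degree at most one and vanishes at a
non-real point.
\<close>

lemma real_poly_factor_cases:
  fixes q :: "real poly"
  assumes "0 < degree q"
  obtains (linear) t where "[:- t, 1:] dvd q"
  | (quadratic) a b where "b \<noteq> 0" "[:a\<^sup>2 + b\<^sup>2, - 2 * a, 1:] dvd q"
proof -
  have "degree (map_poly complex_of_real q) = degree q"
    by (rule degree_map_poly) simp
  then obtain z where z: "poly (map_poly complex_of_real q) z = 0"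
    using fundamental_theorem_of_algebra[of "map_poly complex_of_real q"] assms
    by (auto simp: constant_degree)
  define a b where "a = Re z" and "b = Im z"
  show ?thesis
  proof (cases "b = 0")
    case True
    then have za: "z = complex_of_real a" by (simp add: a_def b_def complex_eq_iff)
    have "poly (map_poly complex_of_real q) (complex_of_real a) = complex_of_real (poly q a)"
      by (induction q) (simp_all add: map_poly_pCons)
    then have "poly q a = 0" using z za by simp
    then show ?thesis using linear[of a] by (simp add: poly_eq_0_iff_dvd)
  next
    case False
    define m where "m = [:a\<^sup>2 + b\<^sup>2, - 2 * a, 1:]"
    have mz: "poly (map_poly complex_of_real m) z = 0"
      by (simp add: m_def map_poly_pCons a_def b_def complex_eq_iff power2_eq_square algebra_simps)
    define r where "r = q mod m"
    have "q = m * (q div m) + r" by (simp add: r_def)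
    then have rz: "poly (map_poly complex_of_real r) z = 0"
      using z mz by (metis poly_map_of_real_add poly_map_of_real_mult mult_zero_left add_0)
    have "degree r < 2 \<or> r = 0"
      using degree_mod_less[of m q] by (auto simp: m_def r_def)
    then have "degree r \<le> 1" by auto
    then have r: "r = [:coeff r 0, coeff r 1:]"
      by (intro poly_eqI) (auto simp: coeff_pCons coeff_eq_0 split: nat.split)
    have "complex_of_real (coeff r 0) + z * complex_of_real (coeff r 1) = 0"
      using rz by (subst (asm) r) (simp add: map_poly_pCons)
    then have "coeff r 1 = 0" "coeff r 0 = 0"
      using False by (auto simp: complex_eq_iff b_def)
    then have "r = 0" using r by simp
    then show ?thesis using quadratic[OF False] by (simp add: m_def r_def dvd_eq_mod_eq_0)
  qed
qed

lemma sum_operator_apply: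
  fixes F :: "'i \<Rightarrow> ('o \<Rightarrow> complex) \<Rightarrow> ('o \<Rightarrow> complex)"
  shows "(\<Sum>i\<in>I. F i) f = (\<Sum>i\<in>I. F i f)"
  by (induction I rule: infinite_finite_induct) simp_all

context hilbert_function_space
begin

lemma vecs_sum [simp]: "(\<And>i. i \<in> I \<Longrightarrow> F i \<in> vecs X) \<Longrightarrow> (\<Sum>i\<in>I. F i) \<in> vecs X"
  by (induction I rule: infinite_finite_induct) auto

lemma bops_sum_vecs:
  assumes A: "A \<in> bops X" and F: "\<And>i. i \<in> I \<Longrightarrow> F i \<in> vecs X"
  shows "A (\<Sum>i\<in>I. F i) = (\<Sum>i\<in>I. A (F i))"
  using F by (induction I rule: infinite_finite_induct) (simp_all add: bops_zero[OF A] bops_add[OF A])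

lemma smul_sum: "smul c (\<Sum>i\<in>I. F i) = (\<Sum>i\<in>I. smul c (F i))"
  by (induction I rule: infinite_finite_induct) (simp_all add: smul_add)

lemma funpow_vecs:
  assumes A: "A \<in> bops X" and f: "f \<in> vecs X"
  shows "(A ^^ i) f \<in> vecs X"
  using f by (induction i) (simp_all add: bops_closed[OF A])

lemma op_poly_apply:
  assumes A: "A \<in> bops X" and f: "f \<in> vecs X" and N: "degree p \<le> N"
  shows "op_poly X p A f = (\<Sum>i\<le>N. smul (complex_of_real (coeff p i)) ((A ^^ i) f))"
proof -
  have "op_poly X p A f = (\<Sum>i\<le>degree p. smul (complex_of_real (coeff p i)) ((A ^^ i) f))"
    using f by (simp add: op_poly_def sum_operator_apply op_scale_def)
  also have "\<dots> = (\<Sum>i\<le>N. smul (complex_of_real (coeff p i)) ((A ^^ i) f))"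
    by (rule sum.mono_neutral_left) (use N in \<open>auto simp: coeff_eq_0\<close>)
  finally show ?thesis .
qed

lemma op_poly_outside:
  assumes A: "A \<in> bops X" and f: "f \<notin> vecs X"
  shows "op_poly X p A f = 0"
proof -
  have "(A ^^ i) 0 = 0" for i by (induction i) (simp_all add: bops_zero[OF A])
  then show ?thesis using f by (simp add: op_poly_def sum_operator_apply op_scale_def op_id_def)
qed

text \<open>
Horner's scheme; all algebraic rules for polynomials of an operator follow from it by induction.
\<close>

lemma op_poly_pCons:
  assumes A: "A \<in> bops X"
  shows "op_poly X (pCons a p) A = op_scale (complex_of_real a) (op_id X) + (A \<circ> op_poly X p A)"
proof (rule ext)
  fix f
  show "op_poly X (pCons a p) A f = (op_scale (complex_of_real a) (op_id X) + (A \<circ> op_poly X p A)) f"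
  proof (cases "f \<in> vecs X")
    case True
    note [simp] = funpow_vecs[OF A True]
    have "op_poly X (pCons a p) A f =
        (\<Sum>i\<le>Suc (degree p). smul (complex_of_real (coeff (pCons a p) i)) ((A ^^ i) f))"
      by (rule op_poly_apply[OF A True degree_pCons_le])
    also have "\<dots> = smul (complex_of_real a) f +
        (\<Sum>i\<le>degree p. A (smul (complex_of_real (coeff p i)) ((A ^^ i) f)))"
      by (subst sum.atMost_Suc_shift) (simp add: bops_smul[OF A])
    also have "(\<Sum>i\<le>degree p. A (smul (complex_of_real (coeff p i)) ((A ^^ i) f))) = A (op_poly X p A f)"
      by (simp add: bops_sum_vecs[OF A] op_poly_apply[OF A True order_refl])
    finally show ?thesis using True by (simp add: op_scale_def)
  next
    case False
    then show ?thesis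
      by (simp add: op_poly_outside[OF A] op_scale_def op_id_def bops_zero[OF A])
  qed
qed

lemma op_poly_0 [simp]: "op_poly X 0 A = 0"
  by (simp add: fun_eq_iff pointwise op_poly_def op_scale_def)

lemma op_poly_bops [simp]:
  assumes A: "A \<in> bops X"
  shows "op_poly X p A \<in> bops X"
proof (induction p)
  case 0
  show ?case unfolding op_poly_0 by (rule bops_zero_op)
next
  case (pCons a p)
  show ?case
    unfolding op_poly_pCons[OF A]
    by (intro bops_plus_op bops_op_scale bops_compose A pCons.IH op_id_bops of_real_scalars)
qed

lemma op_poly_pCons_apply:
  assumes A: "A \<in> bops X" and f: "f \<in> vecs X"
  shows "op_poly X (pCons a p) A f = smul (complex_of_real a) f + A (op_poly X p A f)"
  using f by (simp add: op_poly_pCons[OF A] op_scale_def)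

lemma op_poly_add:
  assumes A: "A \<in> bops X" and f: "f \<in> vecs X"
  shows "op_poly X (p + q) A f = op_poly X p A f + op_poly X q A f"
proof -
  let ?N = "max (degree p) (degree q)"
  show ?thesis
    using op_poly_apply[OF A f, of "p + q" ?N] op_poly_apply[OF A f, of p ?N]
      op_poly_apply[OF A f, of q ?N] degree_add_le_max[of p q]
    by (simp add: smul_add_left sum.distrib)
qed

lemma op_poly_smult:
  assumes A: "A \<in> bops X" and f: "f \<in> vecs X"
  shows "op_poly X (smult a p) A f = smul (complex_of_real a) (op_poly X p A f)"
  using op_poly_apply[OF A f, of "smult a p" "degree p"] op_poly_apply[OF A f, of p "degree p"]
  by (simp add: smul_sum degree_smult_le)

lemma op_poly_diff:
  assumes A: "A \<in> bops X" and f: "f \<in> vecs X"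
  shows "op_poly X (p - q) A f = op_poly X p A f - op_poly X q A f"
  using op_poly_add[OF A f, of "p - q" q] by (simp add: eq_diff_eq)

lemma op_poly_mult:
  assumes A: "A \<in> bops X" and f: "f \<in> vecs X"
  shows "op_poly X (p * q) A f = op_poly X p A (op_poly X q A f)"
proof (induction p)
  case (pCons a p)
  have "op_poly X q A f \<in> vecs X" using f by (simp add: bops_closed[OF op_poly_bops[OF A]])
  then show ?case
    using pCons f
    by (simp add: op_poly_add[OF A] op_poly_smult[OF A] op_poly_pCons_apply[OF A])
qed simp

lemma op_poly_const:
  assumes A: "A \<in> bops X" and f: "f \<in> vecs X"
  shows "op_poly X [:a:] A f = smul (complex_of_real a) f"
  using op_poly_pCons_apply[OF A f, of a 0] by (simp add: bops_zero[OF A])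

lemma op_poly_linear:
  assumes A: "A \<in> bops X" and f: "f \<in> vecs X"
  shows "op_poly X [:a, b:] A f = smul (complex_of_real a) f + smul (complex_of_real b) (A f)"
  using f by (simp add: op_poly_pCons_apply[OF A] op_poly_const[OF A] bops_smul[OF A] bops_zero[OF A])

text \<open>
Polynomials of \<open>A\<close> commute with \<open>A\<close>, which lets \<open>A\<close> be moved across the inner product in the induction.
\<close>

lemma selfadjoint_op_poly:
  assumes A: "selfadjoint A"
  shows "selfadjoint (op_poly X p A)"
proof -
  note Ab = selfadjoint_bops[OF A]
  note [simp] = bops_linear[OF Ab] bops_closed[OF op_poly_bops[OF Ab]]
  have comm: "A (op_poly X p A f) = op_poly X p A (A f)" if "f \<in> vecs X" for p f
    using that by (induction p) (simp_all add: op_poly_pCons_apply[OF Ab])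
  have "ip X (op_poly X p A f) g = ip X f (op_poly X p A g)" if "f \<in> vecs X" "g \<in> vecs X" for f g
    using that
  proof (induction p arbitrary: f g)
    case (pCons a p)
    have "ip X (A (op_poly X p A f)) g = ip X f (A (op_poly X p A g))"
      using pCons by (simp add: selfadjointD[OF A] comm)
    then show ?case using pCons.prems by (simp add: op_poly_pCons_apply[OF Ab] ip_simps)
  qed simp
  then show ?thesis using Ab by (simp add: selfadjoint_def)
qed

definition bounded_below :: "'o operator \<Rightarrow> bool" where
  "bounded_below B \<longleftrightarrow> (\<exists>c>0. \<forall>f\<in>vecs X. c * nrm X f \<le> nrm X (B f))"

lemma bounded_below_compose:
  assumes B: "bounded_below B" and D: "bounded_below D" "\<And>f. f \<in> vecs X \<Longrightarrow> D f \<in> vecs X"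
  shows "bounded_below (\<lambda>f. B (D f))"
proof -
  obtain b where b: "b > 0" "\<And>f. f \<in> vecs X \<Longrightarrow> b * nrm X f \<le> nrm X (B f)"
    using B by (auto simp: bounded_below_def)
  obtain d where d: "d > 0" "\<And>f. f \<in> vecs X \<Longrightarrow> d * nrm X f \<le> nrm X (D f)"
    using D(1) by (auto simp: bounded_below_def)
  have "b * d * nrm X f \<le> nrm X (B (D f))" if f: "f \<in> vecs X" for f
  proof -
    have "b * (d * nrm X f) \<le> b * nrm X (D f)"
      using d(2)[OF f] b(1) by (intro mult_left_mono) auto
    then show ?thesis using b(2)[OF D(2)[OF f]] by (simp add: mult.assoc)
  qed
  then show ?thesis unfolding bounded_below_def using b d by (intro exI[of _ "b * d"]) auto
qed

lemma bounded_below_cong: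
  "(\<And>f. f \<in> vecs X \<Longrightarrow> B f = D f) \<Longrightarrow> bounded_below B \<longleftrightarrow> bounded_below D"
  by (simp add: bounded_below_def)

text \<open>
The quadratic form of \<open>(A - a)\<^sup>2 + b\<^sup>2\<close> is \<open>\<parallel>A f - a f\<parallel>\<^sup>2 + b\<^sup>2 \<parallel>f\<parallel>\<^sup>2\<close>.
\<close>

lemma bounded_below_quadratic:
  assumes A: "selfadjoint A" and b: "b \<noteq> 0"
  shows "bounded_below (op_poly X [:a\<^sup>2 + b\<^sup>2, - 2 * a, 1:] A)"
proof -
  note Ab = selfadjoint_bops[OF A]
  note [simp] = bops_linear[OF Ab]
  have "b\<^sup>2 * nrm X f \<le> nrm X (op_poly X [:a\<^sup>2 + b\<^sup>2, - 2 * a, 1:] A f)" (is "_ \<le> nrm X ?g")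
    if f: "f \<in> vecs X" for f
  proof (cases "nrm X f = 0")
    case False
    have g: "?g = smul (complex_of_real (a\<^sup>2 + b\<^sup>2)) f +
        (smul (complex_of_real (- 2 * a)) (A f) + A (A f))"
    proof -
      have "A (smul (complex_of_real (- 2 * a)) f + smul (complex_of_real 1) (A f)) =
          smul (complex_of_real (- 2 * a)) (A f) + A (A f)"
        using f by (simp only: bops_add[OF Ab] bops_smul[OF Ab] of_real_scalars vecs_closed
            bops_closed[OF Ab] of_real_1 smul_one)
      then show ?thesis
        using f by (subst op_poly_pCons_apply[OF Ab f]) (simp only: op_poly_linear[OF Ab])
    qed
    have gv: "?g \<in> vecs X" using f bops_closed[OF op_poly_bops[OF Ab]] by blast
    have "Re (ip X ?g f) = (a\<^sup>2 + b\<^sup>2) * (nrm X f)\<^sup>2 - 2 * a * Re (ip X (A f) f) + (nrm X (A f))\<^sup>2"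
      unfolding g using f by (simp add: ip_simps nrm_sq selfadjointD[OF A] del: of_real_add of_real_mult of_real_minus)
    moreover have "(nrm X (A f - smul (complex_of_real a) f))\<^sup>2 =
        a\<^sup>2 * (nrm X f)\<^sup>2 - 2 * a * Re (ip X (A f) f) + (nrm X (A f))\<^sup>2"
      using f by (simp add: nrm_sq ip_simps selfadjointD[OF A])
        (simp add: power2_eq_square algebra_simps)
    ultimately have "Re (ip X ?g f) = b\<^sup>2 * (nrm X f)\<^sup>2 + (nrm X (A f - smul (complex_of_real a) f))\<^sup>2"
      by (simp add: algebra_simps)
    then have "b\<^sup>2 * (nrm X f)\<^sup>2 \<le> Re (ip X ?g f)" by simp
    also have "\<dots> \<le> nrm X ?g * nrm X f"
      using complex_Re_le_cmod[of "ip X ?g f"] cauchy_schwarz[OF gv f] by linarith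
    finally have "(b\<^sup>2 * nrm X f) * nrm X f \<le> nrm X ?g * nrm X f"
      by (simp add: power2_eq_square mult.assoc)
    moreover have "0 < nrm X f" using False nrm_nonneg[OF f] by linarith
    ultimately show ?thesis by (rule mult_right_le_imp_le)
  qed (use f bops_closed[OF op_poly_bops[OF Ab]] in simp)
  then show ?thesis unfolding bounded_below_def using b by (intro exI[of _ "b\<^sup>2"]) auto
qed

text \<open>
Spectral mapping in the form needed here.  Each linear factor is bounded below because its root is
not in the spectrum, each irreducible quadratic factor always is, and the property is multiplicative.
\<close>

lemma bounded_below_op_poly:
  assumes A: "selfadjoint A"
    and "q \<noteq> 0" "\<And>t. complex_of_real t \<in> op_spectrum X A \<Longrightarrow> poly q t \<noteq> 0"
  shows "bounded_below (op_poly X q A)"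
  using assms(2,3)
proof (induction "degree q" arbitrary: q rule: less_induct)
  case less
  note Ab = selfadjoint_bops[OF A]
  show ?case
  proof (cases "degree q = 0")
    case True
    then obtain c where c: "q = [:c:]" by (auto elim: degree_eq_zeroE)
    have "bounded_below (smul (complex_of_real c))"
      unfolding bounded_below_def using less.prems(1) c
      by (intro exI[of _ "\<bar>c\<bar>"]) (auto simp: nrm_smul)
    then show ?thesis
      using c by (subst bounded_below_cong[of _ "smul (complex_of_real c)"]) (auto simp: op_poly_const[OF Ab])
  next
    case False
    have step: "bounded_below (op_poly X q A)"
      if qd: "q = m * d" "0 < degree m" and m: "bounded_below (op_poly X m A)" for m d
    proof -
      have "d \<noteq> 0" "m \<noteq> 0" using qd(1) less.prems(1) by auto
      then have "degree d < degree q" using qd by (simp add: degree_mult_eq)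
      then have "bounded_below (op_poly X d A)"
        using \<open>d \<noteq> 0\<close> less.prems(2) qd(1) by (intro less.hyps) auto
      then have "bounded_below (\<lambda>f. op_poly X m A (op_poly X d A f))"
        using bops_closed[OF op_poly_bops[OF Ab]] by (intro bounded_below_compose[OF m]) auto
      then show ?thesis
        using qd(1) by (subst bounded_below_cong[where D = "\<lambda>f. op_poly X m A (op_poly X d A f)"])
          (auto simp: op_poly_mult[OF Ab])
    qed
    from False have "0 < degree q" by simp
    then show ?thesis
    proof (cases rule: real_poly_factor_cases)
      case (linear t)
      then obtain d where d: "q = [:- t, 1:] * d" by (elim dvdE)
      then have "complex_of_real t \<notin> op_spectrum X A" using less.prems(2)[of t] by auto
      then obtain c where "0 < c"
        "\<And>f. f \<in> vecs X \<Longrightarrow> c * nrm X f \<le> nrm X (A f - smul (complex_of_real t) f)"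
        using bounded_below_off_spectrum[OF Ab] by metis
      moreover have "op_poly X [:- t, 1:] A f = A f - smul (complex_of_real t) f" if "f \<in> vecs X" for f
        using that by (simp add: op_poly_linear[OF Ab] fun_eq_iff pointwise)
      ultimately have "bounded_below (op_poly X [:- t, 1:] A)"
        unfolding bounded_below_def by auto
      then show ?thesis by (rule step[OF d, rotated]) simp
    next
      case (quadratic b a)
      then obtain d where d: "q = [:b\<^sup>2 + a\<^sup>2, - 2 * b, 1:] * d" by (elim dvdE)
      show ?thesis
        by (rule step[OF d _ bounded_below_quadratic[OF A quadratic(1)]]) simp
    qed
  qed
qed

section \<open>The operator norm\<close>

lemma op_norm_bdd:
  assumes A: "A \<in> bops X"
  shows "bdd_above ((\<lambda>f. nrm X (A f)) ` {f \<in> vecs X. nrm X f \<le> 1})"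
proof -
  obtain C where C: "C \<ge> 0" "\<And>f. f \<in> vecs X \<Longrightarrow> nrm X (A f) \<le> C * nrm X f"
    using bops_bounded[OF A] by metis
  show ?thesis
  proof (rule bdd_aboveI2[where M = C])
    fix f assume "f \<in> {f \<in> vecs X. nrm X f \<le> 1}"
    then show "nrm X (A f) \<le> C"
      using C(2)[of f] mult_left_mono[of "nrm X f" 1 C] C(1) by auto
  qed
qed

lemma op_norm_nonneg:
  assumes A: "A \<in> bops X"
  shows "0 \<le> op_norm X A"
  unfolding op_norm_def
  using cSUP_upper[OF _ op_norm_bdd[OF A], of 0] by (simp add: bops_zero[OF A])

lemma op_norm_bound:
  assumes A: "A \<in> bops X" and f: "f \<in> vecs X"
  shows "nrm X (A f) \<le> op_norm X A * nrm X f"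
proof (cases "nrm X f = 0")
  case True
  then show ?thesis using f nrm_eq_0_iff[OF f] by (simp add: bops_zero[OF A])
next
  case False
  then have pos: "0 < nrm X f" using nrm_nonneg[OF f] by linarith
  define g where "g = smul (complex_of_real (1 / nrm X f)) f"
  have g: "g \<in> vecs X" unfolding g_def using f by (intro vecs_closed of_real_scalars)
  have "nrm X g = 1" unfolding g_def using f pos
    by (subst nrm_smul) (auto simp del: of_real_divide)
  then have "nrm X (A g) \<le> op_norm X A"
    unfolding op_norm_def using g by (intro cSUP_upper[OF _ op_norm_bdd[OF A]]) simp
  moreover have "nrm X (A g) = (1 / nrm X f) * nrm X (A f)"
    unfolding g_def using f pos
    by (subst bops_smul[OF A]) (auto simp: nrm_smul bops_closed[OF A] simp del: of_real_divide)
  ultimately show ?thesis using pos by (simp add: field_simps)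
qed

lemma op_norm_le:
  assumes A: "A \<in> bops X" and b: "0 \<le> b" "\<And>f. f \<in> vecs X \<Longrightarrow> nrm X (A f) \<le> b * nrm X f"
  shows "op_norm X A \<le> b"
  unfolding op_norm_def
proof (rule cSUP_least)
  show "{f \<in> vecs X. nrm X f \<le> 1} \<noteq> {}" by (auto intro!: exI[of _ 0])
  fix f assume "f \<in> {f \<in> vecs X. nrm X f \<le> 1}"
  then show "nrm X (A f) \<le> b"
    using b(2)[of f] mult_left_mono[of "nrm X f" 1 b] b(1) by auto
qed

text \<open>
Vectors \<open>f\<close> of norm one that nearly attain the norm \<open>N\<close> of \<open>S\<close> are approximate eigenvectors of \<open>S\<^sup>2\<close>:
\<open>\<parallel>S\<^sup>2 f - N\<^sup>2 f\<parallel>\<^sup>2 = \<parallel>S\<^sup>2 f\<parallel>\<^sup>2 - 2 N\<^sup>2 \<parallel>S f\<parallel>\<^sup>2 + N\<^sup>4\<close> is at most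
\<open>N\<^sup>4 - N\<^sup>2 \<parallel>S f\<parallel>\<^sup>2\<close>, which tends to zero.
\<close>

lemma not_bounded_below_norm_sq:
  assumes S: "selfadjoint S" and f0: "f0 \<in> vecs X" "f0 \<noteq> 0"
  defines "N \<equiv> op_norm X S"
  shows "\<not> bounded_below (\<lambda>f. S (S f) - smul (complex_of_real (N\<^sup>2)) f)"
proof
  assume "bounded_below (\<lambda>f. S (S f) - smul (complex_of_real (N\<^sup>2)) f)"
  then obtain c where c: "0 < c"
    "\<And>f. f \<in> vecs X \<Longrightarrow> c * nrm X f \<le> nrm X (S (S f) - smul (complex_of_real (N\<^sup>2)) f)"
    unfolding bounded_below_def by blast
  note Sb = selfadjoint_bops[OF S]
  note [simp] = bops_linear[OF Sb]
  have N: "0 \<le> N" "\<And>f. f \<in> vecs X \<Longrightarrow> nrm X (S f) \<le> N * nrm X f"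
    unfolding N_def using op_norm_nonneg[OF Sb] op_norm_bound[OF Sb] by auto
  have key: "N\<^sup>2 * (nrm X (S f))\<^sup>2 \<le> (N\<^sup>2 * N\<^sup>2 - c\<^sup>2) * (nrm X f)\<^sup>2" if f: "f \<in> vecs X" for f
  proof -
    have "(c * nrm X f)\<^sup>2 \<le> (nrm X (S (S f) - smul (complex_of_real (N\<^sup>2)) f))\<^sup>2"
      using c f by (intro power_mono) auto
    also have "\<dots> = (nrm X (S (S f)))\<^sup>2 - 2 * N\<^sup>2 * (nrm X (S f))\<^sup>2 + N\<^sup>2 * N\<^sup>2 * (nrm X f)\<^sup>2"
      using f by (simp add: nrm_sq ip_simps selfadjointD[OF S] algebra_simps del: of_real_power)
    also have "(nrm X (S (S f)))\<^sup>2 \<le> (N * nrm X (S f))\<^sup>2"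
      using N(2)[of "S f"] f by (intro power_mono) auto
    finally show ?thesis by (simp add: power_mult_distrib algebra_simps)
  qed
  have f0n: "0 < nrm X f0" using f0 nrm_eq_0_iff[of f0] nrm_nonneg[of f0] by linarith
  show False
  proof (cases "N = 0")
    case True
    then show False using key[OF f0(1)] c(1) f0n by (simp add: mult_le_0_iff)
  next
    case False
    with N have Np: "0 < N" by simp
    \<comment> \<open>The bound would yield a norm whose square is at most this \<open>d\<close>, which is smaller than \<open>N\<^sup>2\<close>; the
      maximum with zero only keeps the square root meaningful.\<close>
    define d where "d = max 0 (N\<^sup>2 - c\<^sup>2 / N\<^sup>2)"
    have "(nrm X (S f))\<^sup>2 \<le> d * (nrm X f)\<^sup>2" if f: "f \<in> vecs X" for f
    proof -
      have "N\<^sup>2 * (nrm X (S f))\<^sup>2 \<le> N\<^sup>2 * ((N\<^sup>2 - c\<^sup>2 / N\<^sup>2) * (nrm X f)\<^sup>2)"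
      proof -
        have "N\<^sup>2 * (N\<^sup>2 - c\<^sup>2 / N\<^sup>2) = N\<^sup>2 * N\<^sup>2 - c\<^sup>2" using Np by (simp add: right_diff_distrib)
        then show ?thesis using key[OF f] by (simp add: mult.assoc[symmetric])
      qed
      then have "(nrm X (S f))\<^sup>2 \<le> (N\<^sup>2 - c\<^sup>2 / N\<^sup>2) * (nrm X f)\<^sup>2"
        using Np by (simp add: mult_le_cancel_left_pos)
      also have "\<dots> \<le> d * (nrm X f)\<^sup>2" by (intro mult_right_mono) (simp_all add: d_def)
      finally show ?thesis .
    qed
    then have "nrm X (S f) \<le> sqrt d * nrm X f" if f: "f \<in> vecs X" for f
      using that real_sqrt_le_mono[of "(nrm X (S f))\<^sup>2" "d * (nrm X f)\<^sup>2"]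
      by (simp add: real_sqrt_mult)
    then have "N \<le> sqrt d"
      unfolding N_def by (intro op_norm_le[OF Sb]) (auto simp: d_def)
    then have "N\<^sup>2 \<le> d" using Np by (metis d_def max.cobounded1 power_mono real_sqrt_pow2 less_imp_le)
    moreover have "d < N\<^sup>2" using Np c(1) by (simp add: d_def)
    ultimately show False by simp
  qed
qed

text \<open>
The square of some point of the spectrum is \<open>\<parallel>A\<parallel>\<^sup>2\<close>, since \<open>A\<^sup>2 - \<parallel>A\<parallel>\<^sup>2\<close> is not bounded below.
\<close>

lemma spectrum_nonempty:
  assumes A: "selfadjoint A" and f0: "f0 \<in> vecs X" "f0 \<noteq> 0"
  shows "\<exists>t. complex_of_real t \<in> op_spectrum X A"
proof (rule ccontr)
  assume none: "\<nexists>t. complex_of_real t \<in> op_spectrum X A"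
  note Ab = selfadjoint_bops[OF A]
  let ?q = "[:- ((op_norm X A)\<^sup>2), 0, 1:]"
  have "op_poly X ?q A f = A (A f) - smul (complex_of_real ((op_norm X A)\<^sup>2)) f"
    if "f \<in> vecs X" for f
    using that op_poly_pCons_apply[OF Ab that, of "- ((op_norm X A)\<^sup>2)" "[:0, 1:]"]
    by (simp add: op_poly_linear[OF Ab] fun_eq_iff pointwise)
  then have "\<not> bounded_below (op_poly X ?q A)"
    using not_bounded_below_norm_sq[OF A f0] by (subst bounded_below_cong) auto
  moreover have "bounded_below (op_poly X ?q A)"
    using none by (intro bounded_below_op_poly[OF A]) auto
  ultimately show False by blast
qed

text \<open>
If \<open>N = \<parallel>p(A)\<parallel>\<close> exceeded every value of \<open>|p|\<close> on the spectrum, then \<open>p\<^sup>2 - N\<^sup>2\<close> would be negative there, so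
\<open>p(A)\<^sup>2 - N\<^sup>2\<close> would be bounded below, contrary to the choice of \<open>N\<close>.
\<close>

lemma op_poly_norm_bound:
  assumes A: "selfadjoint A"
    and b: "0 \<le> b" "\<And>t. complex_of_real t \<in> op_spectrum X A \<Longrightarrow> \<bar>poly p t\<bar> \<le> b"
    and f: "f \<in> vecs X"
  shows "nrm X (op_poly X p A f) \<le> b * nrm X f"
proof (cases "f = 0")
  case True
  then show ?thesis using b f bops_zero[OF op_poly_bops[OF selfadjoint_bops[OF A]]] by simp
next
  case False
  note Ab = selfadjoint_bops[OF A]
  define S where "S = op_poly X p A"
  define N where "N = op_norm X S"
  have S: "selfadjoint S" unfolding S_def by (rule selfadjoint_op_poly[OF A])
  note Sb = selfadjoint_bops[OF S]
  have "N \<le> b"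
  proof (rule ccontr)
    assume "\<not> N \<le> b"
    then have N: "b < N" by simp
    define q where "q = p * p - [:N\<^sup>2:]"
    have neg: "poly q t < 0" if "complex_of_real t \<in> op_spectrum X A" for t
    proof -
      have "\<bar>poly p t\<bar> < \<bar>N\<bar>" using b(2)[OF that] N b(1) by simp
      then have "(poly p t)\<^sup>2 < N\<^sup>2" by (simp add: abs_square_less_1 flip: abs_le_square_iff not_le)
      then show ?thesis by (simp add: q_def power2_eq_square)
    qed
    \<comment> \<open>The zero polynomial is excluded because it would have to be negative at some point of the spectrum.\<close>
    have "q \<noteq> 0" using neg spectrum_nonempty[OF A f False] by auto
    then have "bounded_below (op_poly X q A)"
      using neg by (intro bounded_below_op_poly[OF A]) force+
    moreover have "op_poly X q A g = S (S g) - smul (complex_of_real (N\<^sup>2)) g" if "g \<in> vecs X" for g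
      using that by (simp only: q_def op_poly_diff[OF Ab] op_poly_mult[OF Ab] op_poly_const[OF Ab] S_def)
    ultimately have "bounded_below (\<lambda>g. S (S g) - smul (complex_of_real (N\<^sup>2)) g)"
      by (rule iffD1[OF bounded_below_cong, rotated])
    then show False using not_bounded_below_norm_sq[OF S f False] by (simp add: N_def)
  qed
  then have "N * nrm X f \<le> b * nrm X f" using f by (intro mult_right_mono) auto
  then show ?thesis using op_norm_bound[OF Sb f] unfolding N_def S_def by linarith
qed

text \<open>
Centre the values of \<open>p\<close>: if they lie in the interval from \<open>0\<close> to \<open>c\<close>, then \<open>p - c/2\<close> is at most \<open>c/2\<close> in
modulus, so the quadratic form of \<open>p(A) - c/2\<close> is at least \<open>- c/2\<close> times the squared norm.
\<close>

lemma op_poly_nonneg: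
  assumes A: "selfadjoint A" and K: "compact K"
    "\<And>t. complex_of_real t \<in> op_spectrum X A \<Longrightarrow> t \<in> K"
    and p: "\<And>t. t \<in> K \<Longrightarrow> 0 \<le> poly p t" and f: "f \<in> vecs X"
  shows "0 \<le> Re (ip X (op_poly X p A f) f)"
proof -
  note Ab = selfadjoint_bops[OF A]
  have "compact (poly p ` K)" by (intro compact_continuous_image K continuous_intros)
  then obtain b where b: "\<And>t. t \<in> K \<Longrightarrow> \<bar>poly p t\<bar> \<le> b"
    using compact_imp_bounded bounded_real by (metis imageI)
  define c where "c = max b 0"
  have c: "0 \<le> c" "\<And>t. t \<in> K \<Longrightarrow> poly p t \<le> c"
    using b by (force simp: c_def)+
  let ?q = "p - [:c / 2:]"
  have pv: "op_poly X p A f \<in> vecs X" using f by (simp add: bops_closed[OF op_poly_bops[OF Ab]])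
  have qv: "op_poly X ?q A f \<in> vecs X" using f by (simp add: bops_closed[OF op_poly_bops[OF Ab]])
  have "nrm X (op_poly X ?q A f) \<le> (c / 2) * nrm X f"
  proof (rule op_poly_norm_bound[OF A _ _ f])
    fix t assume "complex_of_real t \<in> op_spectrum X A"
    then show "\<bar>poly ?q t\<bar> \<le> c / 2" using K(2)[of t] p[of t] c(2)[of t] by (simp add: abs_if)
  qed (use c in simp)
  then have "nrm X (op_poly X ?q A f) * nrm X f \<le> (c / 2) * nrm X f * nrm X f"
    using f by (intro mult_right_mono) auto
  then have "- (c / 2 * (nrm X f)\<^sup>2) \<le> Re (ip X (op_poly X ?q A f) f)"
    using abs_Re_le_cmod[of "ip X (op_poly X ?q A f) f"] cauchy_schwarz[OF qv f]
    by (simp add: power2_eq_square)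
  moreover have "Re (ip X (op_poly X ?q A f) f) =
      Re (ip X (op_poly X p A f) f) - c / 2 * (nrm X f)\<^sup>2"
    using f pv by (simp add: op_poly_diff[OF Ab] op_poly_const[OF Ab] ip_diff ip_smul nrm_sq
        del: of_real_divide)
  ultimately show ?thesis by linarith
qed

end

section \<open>Continuous functional calculus\<close>

lemma uniform_polynomial_approximation:
  fixes g :: "real \<Rightarrow> real"
  assumes K: "compact K" and g: "continuous_on K g"
  obtains p :: "nat \<Rightarrow> real poly" where "uniform_limit K (\<lambda>n. poly (p n)) g sequentially"
proof -
  have "\<exists>p. \<forall>t\<in>K. \<bar>g t - poly p t\<bar> < 1 / real (Suc n)" for n
  proof -
    obtain h where h: "real_polynomial_function h" "\<And>t. t \<in> K \<Longrightarrow> \<bar>g t - h t\<bar> < 1 / real (Suc n)"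
      using Stone_Weierstrass_real_polynomial_function[OF K g, of "1 / real (Suc n)"] by auto
    obtain a m where "h = (\<lambda>t. \<Sum>i\<le>m. a i * t ^ i)"
      using h(1) by (auto simp: real_polynomial_function_iff_sum)
    then have "h = poly (\<Sum>i\<le>m. monom (a i) i)" by (simp add: fun_eq_iff poly_sum poly_monom)
    then show ?thesis using h(2) by blast
  qed
  then obtain p where p: "\<And>n t. t \<in> K \<Longrightarrow> \<bar>g t - poly (p n) t\<bar> < 1 / real (Suc n)" by metis
  have "uniform_limit K (\<lambda>n. poly (p n)) g sequentially"
  proof (rule uniform_limitI)
    fix e :: real assume "0 < e"
    then have "\<forall>\<^sub>F n in sequentially. 1 / real (Suc n) < e"
      using order_tendstoD(2)[OF lim_1_over_n[THEN LIMSEQ_Suc]] by blast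
    then show "\<forall>\<^sub>F n in sequentially. \<forall>t\<in>K. dist (poly (p n) t) (g t) < e"
    proof eventually_elim
      case (elim n)
      show ?case using p[of _ n] elim by (force simp: dist_real_def abs_minus_commute)
    qed
  qed
  then show ?thesis using that by blast
qed

context hilbert_function_space
begin

abbreviation real_spectrum :: "'o operator \<Rightarrow> real set" where
  "real_spectrum A \<equiv> {t. complex_of_real t \<in> op_spectrum X A}"

text \<open>
A compact superset \<open>K\<close> of the spectrum is where functions are continuous and polynomials approximate;
letting it be larger than the spectrum allows two operators to be compared on a common \<open>K\<close>.
\<close>

definition spectrum_within :: "'o operator \<Rightarrow> real set \<Rightarrow> bool" where
  "spectrum_within A K \<longleftrightarrow> selfadjoint A \<and> compact K \<and> real_spectrum A \<subseteq> K"

lemma spectrum_withinD: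
  assumes "spectrum_within A K"
  shows "selfadjoint A" "compact K" "real_spectrum A \<subseteq> K" "A \<in> bops X"
  using assms by (auto simp: spectrum_within_def)

lemma conv_diff:
  assumes u: "conv u f" and v: "conv v g"
  shows "conv (\<lambda>n. u n - v n) (f - g)"
proof -
  have "conv (\<lambda>n. u n + smul (complex_of_real (-1)) (v n)) (f + smul (complex_of_real (-1)) g)"
    by (intro conv_add conv_smul u v of_real_scalars)
  moreover have "a + smul (complex_of_real (-1)) b = a - b" for a b :: "'o \<Rightarrow> complex"
    by (simp only: smul_uminus[symmetric]) simp
  ultimately show ?thesis by (simp only:)
qed

lemma op_poly_close:
  assumes A: "selfadjoint A"
    and p: "uniform_limit (real_spectrum A) (\<lambda>n. poly (p n)) g sequentially"
    and q: "uniform_limit (real_spectrum A) (\<lambda>n. poly (q n)) g sequentially"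
    and e: "0 < e"
  shows "\<exists>N. \<forall>m\<ge>N. \<forall>n\<ge>N. \<forall>f\<in>vecs X.
    nrm X (op_poly X (p m) A f - op_poly X (q n) A f) \<le> e * nrm X f"
proof -
  obtain N1 where N1: "\<And>n t. n \<ge> N1 \<Longrightarrow> t \<in> real_spectrum A \<Longrightarrow> \<bar>poly (p n) t - g t\<bar> < e / 2"
    using uniform_limitD[OF p, of "e / 2"] e by (auto simp: eventually_sequentially dist_real_def)
  obtain N2 where N2: "\<And>n t. n \<ge> N2 \<Longrightarrow> t \<in> real_spectrum A \<Longrightarrow> \<bar>poly (q n) t - g t\<bar> < e / 2"
    using uniform_limitD[OF q, of "e / 2"] e by (auto simp: eventually_sequentially dist_real_def)
  have "nrm X (op_poly X (p m) A f - op_poly X (q n) A f) \<le> e * nrm X f"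
    if mn: "m \<ge> max N1 N2" "n \<ge> max N1 N2" and f: "f \<in> vecs X" for m n f
  proof -
    have "nrm X (op_poly X (p m - q n) A f) \<le> e * nrm X f"
    proof (rule op_poly_norm_bound[OF A _ _ f])
      fix t assume t: "complex_of_real t \<in> op_spectrum X A"
      have "\<bar>poly (p m) t - g t\<bar> < e / 2" "\<bar>poly (q n) t - g t\<bar> < e / 2"
        using N1[of m t] N2[of n t] mn t by auto
      then show "\<bar>poly (p m - q n) t\<bar> \<le> e" unfolding poly_diff by arith
    qed (use e in simp)
    then show ?thesis by (simp only: op_poly_diff[OF selfadjoint_bops[OF A] f])
  qed
  then show ?thesis by blast
qed

text \<open>
By the norm bound for polynomials the sequences \<open>p\<^sub>n(A)\<close> are Cauchy, uniformly on bounded sets, and any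
two of them with the same uniform limit \<open>g\<close> on the spectrum approach each other; so all have a common
limit.  Uniqueness needs at least one such sequence, which the Weierstrass theorem provides.
\<close>

lemma cfc_exists:
  assumes AK: "spectrum_within A K" and g: "continuous_on K g"
  shows "\<exists>!B. B \<in> bops X \<and> (\<forall>p :: nat \<Rightarrow> real poly.
      uniform_limit (real_spectrum A) (\<lambda>n. poly (p n)) g sequentially \<longrightarrow>
      (\<lambda>n. op_norm X (op_poly X (p n) A - B)) \<longlonglongrightarrow> 0)"
proof -
  note A = spectrum_withinD(1)[OF AK] and Ab = spectrum_withinD(4)[OF AK]
  note Pb = op_poly_bops[OF Ab]
  note [simp] = bops_linear[OF Pb]
  obtain p0 where "uniform_limit K (\<lambda>n. poly (p0 n)) g sequentially"
    using uniform_polynomial_approximation[OF spectrum_withinD(2)[OF AK] g] by blast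
  then have p0: "uniform_limit (real_spectrum A) (\<lambda>n. poly (p0 n)) g sequentially"
    by (rule uniform_limit_on_subset) (rule spectrum_withinD(3)[OF AK])
  have "\<exists>h. conv (\<lambda>n. op_poly X (p0 n) A f) h" if f: "f \<in> vecs X" for f
  proof -
    have "\<exists>N. \<forall>m\<ge>N. \<forall>n\<ge>N. nrm X (op_poly X (p0 m) A f - op_poly X (p0 n) A f) < e"
      if e: "0 < e" for e
    proof -
      have pos: "0 < e / (nrm X f + 1)" using e nrm_nonneg[OF f] by (intro divide_pos_pos) linarith+
      obtain N where N: "\<forall>m\<ge>N. \<forall>n\<ge>N. \<forall>f'\<in>vecs X.
          nrm X (op_poly X (p0 m) A f' - op_poly X (p0 n) A f') \<le> e / (nrm X f + 1) * nrm X f'"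
        using op_poly_close[OF A p0 p0 pos] by blast
      have "e * nrm X f < e * (nrm X f + 1)" using e by simp
      then have "e / (nrm X f + 1) * nrm X f < e"
        using nrm_nonneg[OF f] by (simp add: pos_divide_less_eq)
      then show ?thesis using N f by (meson le_less_trans)
    qed
    then show ?thesis using Cauchy_conv[of "\<lambda>n. op_poly X (p0 n) A f"] f
      by (metis bops_closed[OF Pb])
  qed
  then obtain B0 where B0: "\<And>f. f \<in> vecs X \<Longrightarrow> conv (\<lambda>n. op_poly X (p0 n) A f) (B0 f)" by metis
  define B where "B f = (if f \<in> vecs X then B0 f else 0)" for f
  have Bc: "conv (\<lambda>n. op_poly X (p0 n) A f) (B f)" if "f \<in> vecs X" for f
    using B0[OF that] that by (simp add: B_def)
  have Bv: "B f \<in> vecs X" if "f \<in> vecs X" for f using Bc[OF that] by (rule conv_vecs(2))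
  have close: "\<exists>N. \<forall>n\<ge>N. \<forall>f\<in>vecs X. nrm X (op_poly X (p n) A f - B f) \<le> e * nrm X f"
    if p: "uniform_limit (real_spectrum A) (\<lambda>n. poly (p n)) g sequentially" and e: "0 < e" for p e
  proof -
    obtain N where N: "\<forall>m\<ge>N. \<forall>n\<ge>N. \<forall>f\<in>vecs X.
        nrm X (op_poly X (p m) A f - op_poly X (p0 n) A f) \<le> e * nrm X f"
      using op_poly_close[OF A p p0 e] by blast
    have "nrm X (op_poly X (p n) A f - B f) \<le> e * nrm X f" if n: "n \<ge> N" and f: "f \<in> vecs X" for n f
    proof (rule LIMSEQ_le_const2)
      show "(\<lambda>m. nrm X (op_poly X (p n) A f - op_poly X (p0 m) A f)) \<longlonglongrightarrow>
          nrm X (op_poly X (p n) A f - B f)"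
        by (rule conv_nrm[OF conv_diff[OF conv_const Bc[OF f]]]) (use f in simp)
    qed (use N n f in blast)
    then show ?thesis by blast
  qed
  have BB: "B \<in> bops X"
  proof -
    obtain N where N: "\<And>f. f \<in> vecs X \<Longrightarrow> nrm X (op_poly X (p0 N) A f - B f) \<le> 1 * nrm X f"
      using close[OF p0 zero_less_one] by blast
    show ?thesis
    proof (rule bopsI)
      show "B (f + h) = B f + B h" if "f \<in> vecs X" "h \<in> vecs X" for f h
        using conv_add[OF Bc[OF that(1)] Bc[OF that(2)]] Bc[of "f + h"] that
        by (intro conv_unique[of "\<lambda>n. op_poly X (p0 n) A (f + h)"]) simp_all
      show "B (smul c f) = smul c (B f)" if "c \<in> scalars X" "f \<in> vecs X" for c f
        using conv_smul[OF Bc[OF that(2)] that(1)] Bc[of "smul c f"] that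
        by (intro conv_unique[of "\<lambda>n. op_poly X (p0 n) A (smul c f)"]) simp_all
      show "nrm X (B f) \<le> (1 + op_norm X (op_poly X (p0 N) A)) * nrm X f" if f: "f \<in> vecs X" for f
        using nrm_triangle[of "B f - op_poly X (p0 N) A f" "op_poly X (p0 N) A f"] f Bv[OF f] N[OF f]
          op_norm_bound[OF Pb f, of "p0 N"] nrm_minus_commute[of "B f" "op_poly X (p0 N) A f"]
        by (simp add: distrib_right)
    qed (use Bv in \<open>simp_all add: B_def\<close>)
  qed
  show ?thesis
  proof (rule ex1I[of _ B], intro conjI allI impI)
    fix p assume p: "uniform_limit (real_spectrum A) (\<lambda>n. poly (p n)) g sequentially"
    show "(\<lambda>n. op_norm X (op_poly X (p n) A - B)) \<longlonglongrightarrow> 0"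
    proof (rule LIMSEQ_I)
      fix r :: real assume r: "0 < r"
      obtain N where N: "\<forall>n\<ge>N. \<forall>f\<in>vecs X. nrm X (op_poly X (p n) A f - B f) \<le> r / 2 * nrm X f"
        using close[OF p, of "r / 2"] r by auto
      have "op_norm X (op_poly X (p n) A - B) < r" if "n \<ge> N" for n
      proof -
        have "op_norm X (op_poly X (p n) A - B) \<le> r / 2"
          using N that r BB Pb by (intro op_norm_le) auto
        then show ?thesis using r by linarith
      qed
      moreover have "0 \<le> op_norm X (op_poly X (p n) A - B)" for n
        using BB Pb by (intro op_norm_nonneg) auto
      ultimately show "\<exists>no. \<forall>n\<ge>no. norm (op_norm X (op_poly X (p n) A - B) - 0) < r"
        by (intro exI[of _ N]) auto
    qed
  next
    fix B'
    assume B': "B' \<in> bops X \<and> (\<forall>p :: nat \<Rightarrow> real poly.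
      uniform_limit (real_spectrum A) (\<lambda>n. poly (p n)) g sequentially \<longrightarrow>
      (\<lambda>n. op_norm X (op_poly X (p n) A - B')) \<longlonglongrightarrow> 0)"
    then have lim: "(\<lambda>n. op_norm X (op_poly X (p0 n) A - B')) \<longlonglongrightarrow> 0" using p0 by blast
    have B'b: "B' \<in> bops X" using B' by blast
    show "B' = B"
    proof (rule bops_eqI[OF B'b BB])
      fix f assume f: "f \<in> vecs X"
      have "(\<lambda>n. nrm X (op_poly X (p0 n) A f - B' f)) \<longlonglongrightarrow> 0"
      proof (rule LIMSEQ_null_dominated)
        show "(\<lambda>n. op_norm X (op_poly X (p0 n) A - B') * nrm X f) \<longlonglongrightarrow> 0"
          using tendsto_mult_right[OF lim, of "nrm X f"] by simp
        show "nrm X (op_poly X (p0 n) A f - B' f) \<le> op_norm X (op_poly X (p0 n) A - B') * nrm X f" for n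
          using op_norm_bound[OF bops_minus_op[OF Pb B'b] f, of "p0 n"] by simp
      qed (use f bops_closed[OF B'b] in simp)
      then have "conv (\<lambda>n. op_poly X (p0 n) A f) (B' f)"
        using f bops_closed[OF B'b] by (simp add: conv_def)
      then show "B' f = B f" using Bc[OF f] by (rule conv_unique)
    qed
  qed (rule BB)
qed

lemma cfc_bops:
  assumes "spectrum_within A K" "continuous_on K g"
  shows "cfc X g A \<in> bops X"
  using theI'[OF cfc_exists[OF assms]] unfolding cfc_def[symmetric] by (rule conjunct1)

lemma cfc_conv:
  assumes AK: "spectrum_within A K" and g: "continuous_on K g"
    and p: "uniform_limit K (\<lambda>n. poly (p n)) g sequentially" and f: "f \<in> vecs X"
  shows "conv (\<lambda>n. op_poly X (p n) A f) (cfc X g A f)"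
proof -
  note Ab = spectrum_withinD(4)[OF AK]
  note Pb = op_poly_bops[OF Ab] and Gb = cfc_bops[OF AK g]
  have "uniform_limit (real_spectrum A) (\<lambda>n. poly (p n)) g sequentially"
    using p by (rule uniform_limit_on_subset) (rule spectrum_withinD(3)[OF AK])
  then have lim: "(\<lambda>n. op_norm X (op_poly X (p n) A - cfc X g A)) \<longlonglongrightarrow> 0"
    using theI'[OF cfc_exists[OF AK g]] unfolding cfc_def[symmetric] by blast
  have "(\<lambda>n. nrm X (op_poly X (p n) A f - cfc X g A f)) \<longlonglongrightarrow> 0"
  proof (rule LIMSEQ_null_dominated)
    show "(\<lambda>n. op_norm X (op_poly X (p n) A - cfc X g A) * nrm X f) \<longlonglongrightarrow> 0"
      using tendsto_mult_right[OF lim, of "nrm X f"] by simp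
    show "nrm X (op_poly X (p n) A f - cfc X g A f) \<le>
        op_norm X (op_poly X (p n) A - cfc X g A) * nrm X f" for n
      using op_norm_bound[OF bops_minus_op[OF Pb Gb] f, of "p n"] by simp
  qed (use f bops_closed[OF Gb] bops_closed[OF Pb] in simp)
  then show ?thesis using f bops_closed[OF Gb] bops_closed[OF Pb] by (simp add: conv_def)
qed

lemma cfc_selfadjoint:
  assumes AK: "spectrum_within A K" and g: "continuous_on K g"
  shows "selfadjoint (cfc X g A)"
proof -
  note A = spectrum_withinD(1)[OF AK]
  obtain p where p: "uniform_limit K (\<lambda>n. poly (p n)) g sequentially"
    using uniform_polynomial_approximation[OF spectrum_withinD(2)[OF AK] g] by blast
  have "ip X (cfc X g A f) h = ip X f (cfc X g A h)" if f: "f \<in> vecs X" and h: "h \<in> vecs X" for f h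
  proof (rule LIMSEQ_unique)
    show "(\<lambda>n. ip X (op_poly X (p n) A f) h) \<longlonglongrightarrow> ip X (cfc X g A f) h"
      by (rule conv_ip[OF cfc_conv[OF AK g p f] conv_const[OF h]])
    have "(\<lambda>n. ip X f (op_poly X (p n) A h)) \<longlonglongrightarrow> ip X f (cfc X g A h)"
      by (rule conv_ip[OF conv_const[OF f] cfc_conv[OF AK g p h]])
    then show "(\<lambda>n. ip X (op_poly X (p n) A f) h) \<longlonglongrightarrow> ip X f (cfc X g A h)"
      by (simp only: selfadjointD[OF selfadjoint_op_poly[OF A] f h])
  qed
  then show ?thesis using cfc_bops[OF AK g] by (simp add: selfadjoint_def)
qed

text \<open>
Approximants \<open>p\<^sub>n\<close> of \<open>g\<close> eventually satisfy \<open>p\<^sub>n - l + e \<ge> 0\<close> on \<open>K\<close>, so the nonnegativity of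
polynomials gives the inequality up to an error \<open>e\<close>.
\<close>

lemma cfc_ge_poly:
  assumes AK: "spectrum_within A K" and g: "continuous_on K g"
    and l: "\<And>t. t \<in> K \<Longrightarrow> poly l t \<le> g t" and f: "f \<in> vecs X"
  shows "Re (ip X (op_poly X l A f) f) \<le> Re (ip X (cfc X g A f) f)"
proof (rule field_le_epsilon)
  fix r :: real assume r: "0 < r"
  note A = spectrum_withinD(1)[OF AK] and Ab = spectrum_withinD(4)[OF AK]
  have Pv: "op_poly X q A f \<in> vecs X" for q using bops_closed[OF op_poly_bops[OF Ab] f] .
  obtain p where p: "uniform_limit K (\<lambda>n. poly (p n)) g sequentially"
    using uniform_polynomial_approximation[OF spectrum_withinD(2)[OF AK] g] by blast
  \<comment> \<open>The summand \<open>1\<close> keeps the denominator positive when \<open>f = 0\<close>.\<close>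
  define e where "e = r / ((nrm X f)\<^sup>2 + 1)"
  have n1: "0 < (nrm X f)\<^sup>2 + 1" by (rule add_nonneg_pos) simp_all
  have e: "0 < e" unfolding e_def using r n1 by simp
  have er: "e * (nrm X f)\<^sup>2 \<le> r"
    unfolding e_def using r n1 by (simp add: pos_divide_le_eq mult.commute)
  obtain N where N: "\<And>n t. n \<ge> N \<Longrightarrow> t \<in> K \<Longrightarrow> \<bar>poly (p n) t - g t\<bar> < e"
    using uniform_limitD[OF p e] by (auto simp: eventually_sequentially dist_real_def)
  have "Re (ip X (op_poly X l A f) f) - r \<le> Re (ip X (op_poly X (p n) A f) f)" if n: "n \<ge> N" for n
  proof -
    have "0 \<le> Re (ip X (op_poly X (p n - l + [:e:]) A f) f)"
    proof (rule op_poly_nonneg[OF A spectrum_withinD(2)[OF AK] _ _ f])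
      fix t assume "t \<in> K"
      then show "0 \<le> poly (p n - l + [:e:]) t" using N[OF n, of t] l[of t] by simp
    qed (use spectrum_withinD(3)[OF AK] in auto)
    also have "\<dots> = Re (ip X (op_poly X (p n) A f) f) - Re (ip X (op_poly X l A f) f) + e * (nrm X f)\<^sup>2"
      using f Pv by (simp add: op_poly_add[OF Ab f] op_poly_diff[OF Ab f] op_poly_const[OF Ab f] ip_simps nrm_sq)
    finally show ?thesis using er by linarith
  qed
  then have "Re (ip X (op_poly X l A f) f) - r \<le> Re (ip X (cfc X g A f) f)"
    by (intro LIMSEQ_le_const[OF tendsto_Re[OF conv_ip[OF cfc_conv[OF AK g p f] conv_const[OF f]]]]) blast
  then show "Re (ip X (op_poly X l A f) f) \<le> Re (ip X (cfc X g A f) f) + r" by simp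
qed

lemma cfc_positive:
  assumes AK: "spectrum_within A K" and g: "continuous_on K g" and "\<And>t. t \<in> K \<Longrightarrow> 0 \<le> g t"
  shows "positive (cfc X g A)"
  using cfc_selfadjoint[OF AK g] cfc_ge_poly[OF AK g, of 0] assms(3) by (simp add: positive_def)

text \<open>
Moving one self-adjoint factor to the other side of the inner product turns the product of two
limits of operators into a single limit of inner products of convergent vectors.
\<close>

lemma cfc_mult:
  assumes AK: "spectrum_within A K" and g: "continuous_on K g" and h: "continuous_on K h"
    and f: "f \<in> vecs X"
  shows "cfc X (\<lambda>t. g t * h t) A f = cfc X g A (cfc X h A f)"
proof (rule ip_eqI)
  note A = spectrum_withinD(1)[OF AK] and Ab = spectrum_withinD(4)[OF AK] and K = spectrum_withinD(2)[OF AK]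
  have gh: "continuous_on K (\<lambda>t. g t * h t)" using g h by (intro continuous_intros)
  note Gv = bops_closed[OF cfc_bops[OF AK g]] and Hv = bops_closed[OF cfc_bops[OF AK h]]
  show "cfc X (\<lambda>t. g t * h t) A f \<in> vecs X" using bops_closed[OF cfc_bops[OF AK gh] f] .
  show "cfc X g A (cfc X h A f) \<in> vecs X" using Gv Hv f by blast
  obtain p where p: "uniform_limit K (\<lambda>n. poly (p n)) g sequentially"
    using uniform_polynomial_approximation[OF K g] by blast
  obtain q where q: "uniform_limit K (\<lambda>n. poly (q n)) h sequentially"
    using uniform_polynomial_approximation[OF K h] by blast
  have pq: "uniform_limit K (\<lambda>n. poly (p n * q n)) (\<lambda>t. g t * h t) sequentially"
    unfolding poly_mult
    by (intro uniform_lim_mult[OF p q] compact_imp_bounded compact_continuous_image K g h)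
  fix k assume k: "k \<in> vecs X"
  show "ip X (cfc X (\<lambda>t. g t * h t) A f) k = ip X (cfc X g A (cfc X h A f)) k"
  proof (rule LIMSEQ_unique)
    show "(\<lambda>n. ip X (op_poly X (p n * q n) A f) k) \<longlonglongrightarrow> ip X (cfc X (\<lambda>t. g t * h t) A f) k"
      by (rule conv_ip[OF cfc_conv[OF AK gh pq f] conv_const[OF k]])
    have "(\<lambda>n. ip X (op_poly X (q n) A f) (op_poly X (p n) A k)) \<longlonglongrightarrow>
        ip X (cfc X h A f) (cfc X g A k)"
      by (rule conv_ip[OF cfc_conv[OF AK h q f] cfc_conv[OF AK g p k]])
    moreover have "ip X (op_poly X (p n * q n) A f) k = ip X (op_poly X (q n) A f) (op_poly X (p n) A k)" for n
      using selfadjointD[OF selfadjoint_op_poly[OF A] bops_closed[OF op_poly_bops[OF Ab] f] k]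
      by (simp only: op_poly_mult[OF Ab f])
    moreover have "ip X (cfc X h A f) (cfc X g A k) = ip X (cfc X g A (cfc X h A f)) k"
      using selfadjointD[OF cfc_selfadjoint[OF AK g] Hv[OF f] k] by (simp only:)
    ultimately show "(\<lambda>n. ip X (op_poly X (p n * q n) A f) k) \<longlonglongrightarrow> ip X (cfc X g A (cfc X h A f)) k"
      by (simp only:)
  qed
qed

lemma cfc_poly:
  assumes AK: "spectrum_within A K" and g: "\<And>t. t \<in> K \<Longrightarrow> g t = poly p t" and f: "f \<in> vecs X"
  shows "cfc X g A f = op_poly X p A f"
proof (rule conv_unique)
  have "continuous_on K (poly p)" by (intro continuous_intros)
  then have gc: "continuous_on K g" using g by (simp cong: continuous_on_cong)
  have "uniform_limit K (\<lambda>n. poly p) g sequentially"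
    using g by (intro uniform_limitI) simp
  then show "conv (\<lambda>n. op_poly X p A f) (cfc X g A f)" by (rule cfc_conv[OF AK gc _ f])
  show "conv (\<lambda>n. op_poly X p A f) (op_poly X p A f)"
    by (rule conv_const[OF bops_closed[OF op_poly_bops[OF spectrum_withinD(4)[OF AK]] f]])
qed

text \<open>
One sequence of polynomials serves both operators, because it converges uniformly on the common set \<open>K\<close>.
\<close>

lemma cfc_intertwine:
  assumes AK: "spectrum_within A K" and BK: "spectrum_within B K" and g: "continuous_on K g"
    and C: "C \<in> bops X" and CA: "\<And>f. f \<in> vecs X \<Longrightarrow> C (A f) = B (C f)" and f: "f \<in> vecs X"
  shows "C (cfc X g A f) = cfc X g B (C f)"
proof -
  note Ab = spectrum_withinD(4)[OF AK] and Bb = spectrum_withinD(4)[OF BK]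
  obtain p where p: "uniform_limit K (\<lambda>n. poly (p n)) g sequentially"
    using uniform_polynomial_approximation[OF spectrum_withinD(2)[OF AK] g] by blast
  have "C (op_poly X q A f) = op_poly X q B (C f)" for q
  proof (induction q)
    case (pCons a q)
    note [simp] = bops_closed[OF op_poly_bops[OF Ab]] bops_closed[OF Ab] bops_closed[OF C]
    show ?case using pCons f
      by (simp add: op_poly_pCons_apply[OF Ab] op_poly_pCons_apply[OF Bb] bops_add[OF C] bops_smul[OF C] CA)
  qed (simp add: bops_zero[OF C])
  moreover have "conv (\<lambda>n. C (op_poly X (p n) A f)) (C (cfc X g A f))"
    by (rule conv_bounded_op[OF C cfc_conv[OF AK g p f]])
  ultimately have "conv (\<lambda>n. op_poly X (p n) B (C f)) (C (cfc X g A f))" by (simp only:)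
  then show ?thesis
    using cfc_conv[OF BK g p bops_closed[OF C f]] by (rule conv_unique)
qed

end

section \<open>Powers of positive operators\<close>

text \<open>
Convexity of the power function as a tangent inequality.  The operator version (McCarthy) and the
power mean inequality are both obtained from it by averaging.
\<close>

lemma powr_tangent_le:
  fixes a t s :: real
  assumes "1 \<le> s" "0 \<le> a" "0 \<le> t"
  shows "a powr s + s * a powr (s - 1) * (t - a) \<le> t powr s"
proof (cases "a = 0 \<or> t = 0")
  case True
  show ?thesis
  proof (cases "a = 0")
    case False
    then have "t = 0" "0 < a" using True assms by auto
    moreover have "a powr (s - 1) * a = a powr s"
      using \<open>0 < a\<close> by (simp add: powr_diff)
    ultimately have "s * a powr (s - 1) * (t - a) = - (s * a powr s)" by (simp add: mult.assoc)
    moreover have "a powr s \<le> s * a powr s" using assms(1) mult_right_mono[of 1 s "a powr s"] by simp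
    moreover have "t powr s = 0" using \<open>t = 0\<close> assms by simp
    ultimately show ?thesis by linarith
  qed (use assms in simp)
next
  case False
  then have pos: "0 < a" "0 < t" using assms by auto
  have "t powr s - a powr s \<ge> (s * a powr (s - 1)) * (t - a)"
  proof (rule convex_on_imp_above_tangent[OF powr_convex[OF assms(1)]])
    show "((\<lambda>x. x powr s) has_field_derivative s * a powr (s - 1)) (at a within {0<..})"
      using pos by (auto intro!: derivative_eq_intros)
  qed (use pos in \<open>auto simp: interior_open\<close>)
  then show ?thesis by simp
qed

context hilbert_function_space
begin

lemma spectrum_within_positive:
  assumes A: "positive A" and M: "op_norm X A \<le> M"
  shows "spectrum_within A {0..M}"
proof -
  note Ab = selfadjoint_bops[OF positive_selfadjoint[OF A]]
  have bound: "Re (ip X (A f) f) \<le> M * (nrm X f)\<^sup>2" if f: "f \<in> vecs X" for f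
  proof -
    have "Re (ip X (A f) f) \<le> nrm X (A f) * nrm X f"
      using complex_Re_le_cmod[of "ip X (A f) f"] cauchy_schwarz[OF bops_closed[OF Ab f] f] by linarith
    also have "\<dots> \<le> (op_norm X A * nrm X f) * nrm X f"
      using f op_norm_bound[OF Ab f] by (intro mult_right_mono) auto
    also have "\<dots> \<le> (M * nrm X f) * nrm X f"
      using f M by (intro mult_right_mono) auto
    finally show ?thesis by (simp add: power2_eq_square mult.assoc)
  qed
  then show ?thesis
    using spectrum_positive[OF A bound] A by (auto simp: spectrum_within_def)
qed

lemma continuous_on_powr_nonneg: "0 < s \<Longrightarrow> continuous_on {0..M} (\<lambda>t :: real. t powr s)"
  by (intro continuous_on_powr' continuous_intros) auto

lemma op_powr_positive:
  assumes A: "positive A" and s: "0 < s"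
  shows "positive (op_powr X A s)"
  unfolding op_powr_def
  by (rule cfc_positive[OF spectrum_within_positive[OF A order_refl] continuous_on_powr_nonneg[OF s]]) simp

lemma op_powr_add:
  assumes A: "positive A" and s: "0 < s" "0 < t" and f: "f \<in> vecs X"
  shows "op_powr X A (s + t) f = op_powr X A s (op_powr X A t f)"
  unfolding op_powr_def powr_add
  by (rule cfc_mult[OF spectrum_within_positive[OF A order_refl]
        continuous_on_powr_nonneg[OF s(1)] continuous_on_powr_nonneg[OF s(2)] f])

lemma op_powr_one:
  assumes A: "positive A" and f: "f \<in> vecs X"
  shows "op_powr X A 1 f = A f"
proof -
  note Ab = selfadjoint_bops[OF positive_selfadjoint[OF A]]
  have "op_powr X A 1 f = op_poly X [:0, 1:] A f"
    unfolding op_powr_def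
    by (rule cfc_poly[OF spectrum_within_positive[OF A order_refl] _ f]) simp
  then show ?thesis using f by (simp add: op_poly_linear[OF Ab])
qed

text \<open>
Apply the tangent of the power function at \<open>a = \<langle>A f, f\<rangle>\<close> to the operator \<open>A\<close> through the order
property of the calculus; in the state \<open>f\<close> the linear term vanishes by the choice of \<open>a\<close>.
\<close>

lemma mccarthy:
  assumes A: "positive A" and r: "1 \<le> r" and f: "f \<in> vecs X" "nrm X f = 1"
  shows "Re (ip X (A f) f) powr r \<le> Re (ip X (op_powr X A r f) f)"
proof -
  note Ab = selfadjoint_bops[OF positive_selfadjoint[OF A]]
  define a where "a = Re (ip X (A f) f)"
  have a: "0 \<le> a" unfolding a_def by (rule positiveD[OF A f(1)])
  \<comment> \<open>The slope of the tangent; for \<open>a = 0\<close> it is \<open>0\<close>, since \<open>0 powr (r - 1) = 0\<close> even for \<open>r = 1\<close>, and the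
    tangent inequality still holds.\<close>
  define d where "d = r * a powr (r - 1)"
  let ?l = "[:a powr r - d * a, d:]"
  have "Re (ip X (op_poly X ?l A f) f) \<le> Re (ip X (cfc X (\<lambda>t. t powr r) A f) f)"
  proof (rule cfc_ge_poly[OF spectrum_within_positive[OF A order_refl] _ _ f(1)])
    fix t assume "t \<in> {0..op_norm X A}"
    then show "poly ?l t \<le> t powr r"
      using powr_tangent_le[OF r a, of t] by (simp add: d_def algebra_simps)
  qed (use r continuous_on_powr_nonneg in auto)
  moreover have "Re (ip X (op_poly X ?l A f) f) = a powr r"
  proof -
    have ff: "ip X f f = 1" using ip_self[OF f(1)] f(2) by simp
    have "Re (ip X (op_poly X ?l A f) f) = (a powr r - d * a) + d * a"
      using f(1) bops_closed[OF Ab f(1)]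
      by (simp add: op_poly_linear[OF Ab f(1)] ip_simps ff a_def del: of_real_diff of_real_mult)
    then show ?thesis by simp
  qed
  ultimately show ?thesis by (simp add: a_def op_powr_def)
qed

section \<open>The absolute value\<close>

lemma op_abs_positive:
  assumes A: "A \<in> bops X"
  shows "positive (op_abs X A)"
  unfolding op_abs_def by (rule op_powr_positive[OF positive_adj_compose[OF A]]) simp

lemma op_abs_square:
  assumes A: "A \<in> bops X" and f: "f \<in> vecs X"
  shows "op_abs X A (op_abs X A f) = adj X A (A f)"
  using op_powr_add[OF positive_adj_compose[OF A], of "1/2" "1/2" f]
    op_powr_one[OF positive_adj_compose[OF A] f] f
  by (simp add: op_abs_def)

text \<open>
\<open>A (A\<^sup>* A) = (A A\<^sup>*) A\<close>, and this relation passes to the square roots.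
\<close>

lemma op_abs_intertwine:
  assumes A: "A \<in> bops X" and f: "f \<in> vecs X"
  shows "A (op_abs X A f) = op_abs X (adj X A) (A f)"
proof -
  let ?T = "adj X A \<circ> A" and ?T' = "adj X (adj X A) \<circ> adj X A"
  \<comment> \<open>Both spectra lie in one interval, as a common sequence of polynomials is needed.\<close>
  let ?M = "max (op_norm X ?T) (op_norm X ?T')"
  have "spectrum_within ?T {0..?M}"
    by (rule spectrum_within_positive[OF positive_adj_compose[OF A]]) simp
  moreover have "spectrum_within ?T' {0..?M}"
    by (rule spectrum_within_positive[OF positive_adj_compose[OF adj_bops[OF A]]]) simp
  ultimately show ?thesis
    unfolding op_abs_def op_powr_def
    by (rule cfc_intertwine[OF _ _ continuous_on_powr_nonneg A _ f]) (simp_all add: adj_adj[OF A])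
qed

text \<open>
Perturb both absolute values.  For \<open>e > 0\<close> the operator \<open>D = Q + e\<close> is
invertible, and with \<open>E = P + e\<close> one has \<open>D A = A E\<close>.  Writing \<open>y = D w\<close> gives
\<open>\<langle>A x, y\<rangle> = \<langle>E x, A\<^sup>* w\<rangle>\<close>, to which the Schwarz inequality for the positive form of \<open>E\<close> applies.  Its
second factor is \<open>\<langle>D A A\<^sup>* w, w\<rangle> = \<langle>Q\<^sup>2 w, y\<rangle>\<close>, which is at most \<open>\<langle>Q y, y\<rangle>\<close>.  Finally \<open>e\<close> tends to zero.
\<close>

lemma mixed_schwarz:
  assumes A: "A \<in> bops X" and x: "x \<in> vecs X" and y: "y \<in> vecs X"
  shows "(cmod (ip X (A x) y))\<^sup>2 \<le>
    Re (ip X (op_abs X A x) x) * Re (ip X (op_abs X (adj X A) y) y)"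
proof -
  define P where "P = op_abs X A"
  define Q where "Q = op_abs X (adj X A)"
  have P: "positive P" and Q: "positive Q"
    unfolding P_def Q_def using A by (simp_all add: op_abs_positive)
  note Psa = positive_selfadjoint[OF P] and Qsa = positive_selfadjoint[OF Q]
  note [simp] = bops_linear[OF A] bops_linear[OF adj_bops[OF A]]
    bops_linear[OF selfadjoint_bops[OF Psa]] bops_linear[OF selfadjoint_bops[OF Qsa]] x y
  define p q where "p = Re (ip X (P x) x)" and "q = Re (ip X (Q y) y)"
  have q: "0 \<le> q" unfolding q_def by (rule positiveD[OF Q y])
  have eps: "(cmod (ip X (A x) y))\<^sup>2 \<le> (p + e * (nrm X x)\<^sup>2) * q" if e: "0 < e" for e
  proof -
    let ?e = "complex_of_real e"
    \<comment> \<open>Adding \<open>e\<close> is written as subtracting \<open>- e\<close> to match the shape \<open>A - t\<close> used for the spectrum.\<close>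
    define D where "D = Q - op_scale (complex_of_real (- e)) (op_id X)"
    define E where "E = P - op_scale (complex_of_real (- e)) (op_id X)"
    have D_app: "D f = Q f + smul ?e f" and E_app: "E f = P f + smul ?e f" if "f \<in> vecs X" for f
      using that by (simp_all add: D_def E_def op_scale_def fun_eq_iff pointwise)
    have Dsa: "selfadjoint D" and Esa: "selfadjoint E"
      unfolding D_def E_def by (rule selfadjoint_shift[OF Qsa], rule selfadjoint_shift[OF Psa])
    note [simp] = bops_linear[OF selfadjoint_bops[OF Dsa]] bops_linear[OF selfadjoint_bops[OF Esa]]
    have Epos: "positive E"
      unfolding positive_def using Esa positiveD[OF P] e
      by (simp add: E_app ip_simps nrm_sq[symmetric])
    have "\<exists>R\<in>bops X. R \<circ> D = op_id X \<and> D \<circ> R = op_id X"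
    proof (rule invertible_of_coercive[OF Dsa e, of 1])
      show "e * (nrm X f)\<^sup>2 \<le> 1 * Re (ip X (D f) f)" if "f \<in> vecs X" for f
        using that positiveD[OF Q that] by (simp add: D_app ip_simps nrm_sq)
    qed simp
    then obtain R where R: "R \<in> bops X" "D \<circ> R = op_id X" by blast
    define w where "w = R y"
    have w [simp]: "w \<in> vecs X" unfolding w_def by (rule bops_closed[OF R(1) y])
    have Dw: "D w = y" unfolding w_def using fun_cong[OF R(2), of y] by simp
    have DA: "D (A f) = A (E f)" if "f \<in> vecs X" for f
      using that op_abs_intertwine[OF A that] by (simp add: D_app E_app P_def[symmetric] Q_def[symmetric])
    have "ip X (A x) y = ip X (E x) (adj X A w)"
    proof -
      have "ip X (A x) y = ip X (A x) (D w)" by (simp only: Dw)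
      also have "\<dots> = ip X (D (A x)) w" by (simp add: selfadjointD[OF Dsa])
      also have "\<dots> = ip X (E x) (adj X A w)" by (simp add: DA adjD[OF A])
      finally show ?thesis .
    qed
    then have "(cmod (ip X (A x) y))\<^sup>2 \<le>
        Re (ip X (E x) x) * Re (ip X (E (adj X A w)) (adj X A w))"
      using positive_cauchy_schwarz[OF Epos x, of "adj X A w"] by simp
    also have "Re (ip X (E x) x) = p + e * (nrm X x)\<^sup>2"
      by (simp add: E_app ip_simps p_def nrm_sq)
    also have "Re (ip X (E (adj X A w)) (adj X A w)) \<le> q"
    proof -
      have QQ: "A (adj X A w) = Q (Q w)"
        using op_abs_square[OF adj_bops[OF A] w] by (simp add: adj_adj[OF A] Q_def)
      have "ip X (E (adj X A w)) (adj X A w) = ip X (D (A (adj X A w))) w"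
        by (simp add: DA adjD[OF A])
      also have "\<dots> = ip X (Q (Q w)) (D w)" by (simp add: selfadjointD[OF Dsa] QQ)
      finally have "Re (ip X (E (adj X A w)) (adj X A w)) =
          Re (ip X (Q (Q w)) (Q w)) + e * (nrm X (Q w))\<^sup>2"
        by (simp add: D_app ip_simps nrm_sq selfadjointD[OF Qsa])
      moreover have "q = Re (ip X (Q (Q w)) (Q w)) + 2 * e * (nrm X (Q w))\<^sup>2 + e\<^sup>2 * Re (ip X (Q w) w)"
        unfolding q_def Dw[symmetric]
        by (simp add: D_app ip_simps nrm_sq selfadjointD[OF Qsa])
          (simp add: power2_eq_square algebra_simps)
      moreover have "0 \<le> e\<^sup>2 * Re (ip X (Q w) w)" using positiveD[OF Q w] by simp
      moreover have "0 \<le> e * (nrm X (Q w))\<^sup>2" using e by simp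
      ultimately show ?thesis by linarith
    qed
    finally show ?thesis
      using positiveD[OF Epos x] by (simp add: E_app ip_simps p_def nrm_sq mult_left_mono)
  qed
  have "((\<lambda>e. (p + e * (nrm X x)\<^sup>2) * q) \<longlongrightarrow> (p + 0 * (nrm X x)\<^sup>2) * q) (at_right 0)"
    by (intro tendsto_intros)
  then have "(cmod (ip X (A x) y))\<^sup>2 \<le> (p + 0 * (nrm X x)\<^sup>2) * q"
    by (rule tendsto_lowerbound) (use eps in \<open>auto simp: eventually_at_right_less eventually_at_filter\<close>)
  then show ?thesis by (simp add: p_def q_def P_def Q_def)
qed

text \<open>
The whole theorem for one operator and one unit vector: mixed Schwarz, McCarthy, Buzano and the
arithmetic-geometric mean inequality in this order.
\<close>

lemma unit_vector_estimate:
  assumes A: "A \<in> bops X" and r: "1 \<le> r" and x: "x \<in> vecs X" "nrm X x = 1"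
  shows "cmod (ip X (A x) x) powr (2 * r) \<le>
    Re (ip X (op_powr X (op_abs X A) (2 * r) x + op_powr X (op_abs X (adj X A)) (2 * r) x) x) / 4
    + cmod (ip X (op_powr X (op_abs X A) r (op_powr X (op_abs X (adj X A)) r x)) x) / 2"
proof -
  define P where "P = op_abs X A"
  define Q where "Q = op_abs X (adj X A)"
  have P: "positive P" and Q: "positive Q"
    unfolding P_def Q_def using A by (simp_all add: op_abs_positive)
  have r0: "0 < r" using r by simp
  have pow: "positive (op_powr X P r)" "positive (op_powr X Q r)"
    "positive (op_powr X P (2 * r))" "positive (op_powr X Q (2 * r))"
    using P Q r0 by (simp_all add: op_powr_positive)
  note sa = pow[THEN positive_selfadjoint]
  note [simp] = sa[THEN selfadjoint_bops, THEN bops_closed] x(1)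
  define a b where "a = op_powr X P r x" and "b = op_powr X Q r x"
  have [simp]: "a \<in> vecs X" "b \<in> vecs X" by (simp_all add: a_def b_def)
  have px: "0 \<le> Re (ip X (P x) x)" and qx: "0 \<le> Re (ip X (Q x) x)"
    using positiveD[OF P x(1)] positiveD[OF Q x(1)] .
  have norms: "Re (ip X (op_powr X P (2 * r) x) x) = (nrm X a)\<^sup>2"
    "Re (ip X (op_powr X Q (2 * r) x) x) = (nrm X b)\<^sup>2"
    using op_powr_add[OF P r0 r0 x(1)] op_powr_add[OF Q r0 r0 x(1)]
    by (simp_all add: nrm_sq a_def b_def selfadjointD[OF sa(1)] selfadjointD[OF sa(2)])
  have "cmod (ip X (A x) x) powr (2 * r) = ((cmod (ip X (A x) x))\<^sup>2) powr r"
    by (simp add: powr_powr flip: powr_numeral)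
  also have "\<dots> \<le> (Re (ip X (P x) x) * Re (ip X (Q x) x)) powr r"
    using mixed_schwarz[OF A x(1) x(1)] r0 by (intro powr_mono2) (auto simp: P_def Q_def)
  also have "\<dots> = Re (ip X (P x) x) powr r * Re (ip X (Q x) x) powr r"
    using px qx by (simp add: powr_mult)
  also have "\<dots> \<le> Re (ip X a x) * Re (ip X b x)"
    unfolding a_def b_def using mccarthy[OF P r x] mccarthy[OF Q r x]
    by (intro mult_mono) (auto intro: order_trans[OF powr_ge_zero])
  also have "\<dots> \<le> cmod (ip X a x) * cmod (ip X x b)"
  proof (rule mult_mono)
    show "Re (ip X b x) \<le> cmod (ip X x b)"
      using complex_Re_le_cmod[of "ip X x b"] by (simp add: Re_ip_commute)
    show "0 \<le> Re (ip X b x)" unfolding b_def by (rule positiveD[OF pow(2) x(1)])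
  qed (auto intro: complex_Re_le_cmod)
  also have "\<dots> \<le> (nrm X a * nrm X b + cmod (ip X a b)) / 2"
    by (rule buzano) (simp_all add: x(2))
  also have "\<dots> \<le> ((nrm X a)\<^sup>2 + (nrm X b)\<^sup>2) / 4 + cmod (ip X a b) / 2"
    using sum_squares_bound[of "nrm X a" "nrm X b"] by (simp add: field_simps)
  also have "cmod (ip X a b) = cmod (ip X (op_powr X P r (op_powr X Q r x)) x)"
  proof -
    have "ip X a b = ip X x (op_powr X P r b)" by (simp add: a_def selfadjointD[OF sa(1)])
    also have "\<dots> = cnj (ip X (op_powr X P r b) x)" by (rule ip_cnj) simp_all
    finally show ?thesis by (simp add: b_def)
  qed
  finally show ?thesis
    by (simp add: ip_add norms flip: P_def Q_def)
qed

end

section \<open>Berezin numbers\<close>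

text \<open>
Sum the tangent inequality at the mean \<open>a\<close> of the values; the linear terms cancel.
\<close>

lemma power_mean_powr:
  fixes v :: "'i \<Rightarrow> real"
  assumes "finite I" "I \<noteq> {}" "\<And>i. i \<in> I \<Longrightarrow> 0 \<le> v i" "1 \<le> s"
  shows "(\<Sum>i\<in>I. v i) powr s \<le> real (card I) powr (s - 1) * (\<Sum>i\<in>I. v i powr s)"
proof -
  define n where "n = real (card I)"
  have n: "0 < n" using assms by (simp add: n_def card_gt_0_iff)
  define a where "a = (\<Sum>i\<in>I. v i) / n"
  have a: "0 \<le> a" unfolding a_def using n assms by (intro divide_nonneg_pos sum_nonneg)
  have na: "n * a = (\<Sum>i\<in>I. v i)" using n by (simp add: a_def)
  have "n * a powr s = (\<Sum>i\<in>I. a powr s + s * a powr (s - 1) * (v i - a))"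
    using na by (simp add: sum.distrib sum_distrib_left[symmetric] sum_subtractf n_def)
  also have "\<dots> \<le> (\<Sum>i\<in>I. v i powr s)"
    using assms a by (intro sum_mono powr_tangent_le) auto
  finally have "n powr (s - 1) * (n * a powr s) \<le> n powr (s - 1) * (\<Sum>i\<in>I. v i powr s)"
    by (intro mult_left_mono) auto
  moreover have "n powr (s - 1) * (n * a powr s) = (n * a) powr s"
    using n a by (simp add: powr_mult powr_diff)
  ultimately have "(n * a) powr s \<le> n powr (s - 1) * (\<Sum>i\<in>I. v i powr s)" by simp
  then show ?thesis unfolding na unfolding n_def .
qed

context rkhs
begin

lemma ber_upper:
  assumes A: "A \<in> bops X" and x: "x \<in> points X"
  shows "cmod (ip X (A (nkernel X x)) (nkernel X x)) \<le> ber X A"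
  unfolding ber_def
proof (rule cSUP_upper[OF x], rule bdd_aboveI2[where M = "op_norm X A"])
  fix y assume "y \<in> points X"
  then show "cmod (ip X (A (nkernel X y)) (nkernel X y)) \<le> op_norm X A"
    using cauchy_schwarz[of "A (nkernel X y)" "nkernel X y"] op_norm_bound[OF A, of "nkernel X y"]
    by (simp add: bops_closed[OF A])
qed

lemma ber_nonneg:
  assumes "A \<in> bops X"
  shows "0 \<le> ber X A"
  using ber_upper[OF assms] points_nonempty norm_ge_zero by (meson all_not_in_conv order_trans)

text \<open>
Taking the power commutes with the supremum because the power function is increasing with an
increasing inverse on the nonnegative reals.
\<close>

lemma ber_powr_le:
  assumes s: "0 < s" and C: "0 \<le> C"
    and le: "\<And>x. x \<in> points X \<Longrightarrow> cmod (ip X (A (nkernel X x)) (nkernel X x)) powr s \<le> C"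
    and A: "A \<in> bops X"
  shows "ber X A powr s \<le> C"
proof -
  have "ber X A \<le> C powr (1 / s)"
    unfolding ber_def
  proof (rule cSUP_least[OF points_nonempty])
    fix x assume "x \<in> points X"
    from powr_mono2[OF _ _ le[OF this], of "1 / s"]
    show "cmod (ip X (A (nkernel X x)) (nkernel X x)) \<le> C powr (1 / s)"
      using s by (simp add: powr_powr)
  qed
  from powr_mono2[OF _ ber_nonneg[OF A] this, of s]
  show ?thesis using s C by (simp add: powr_powr)
qed

lemma ip_sum_left:
  assumes "\<And>i. i \<in> I \<Longrightarrow> F i \<in> vecs X" "g \<in> vecs X"
  shows "ip X (\<Sum>i\<in>I. F i) g = (\<Sum>i\<in>I. ip X (F i) g)"
  using assms by (induction I rule: infinite_finite_induct) (simp_all add: ip_add)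

lemma ber_sum_powr_le:
  fixes A :: "nat \<Rightarrow> 'o operator" and n :: nat
  assumes n: "1 \<le> n" and A: "\<And>i. i \<in> {1..n} \<Longrightarrow> A i \<in> bops X" and r: "1 \<le> r"
  shows "ber X (\<Sum>i=1..n. A i) powr (2 * r)
    \<le> real n powr (2 * r - 1) / 4 *
        ber X (\<Sum>i=1..n. op_powr X (op_abs X (A i)) (2 * r) + op_powr X (op_abs X (adj X (A i))) (2 * r))
      + real n powr (2 * r - 1) / 2 *
        (\<Sum>i=1..n. ber X (op_powr X (op_abs X (A i)) r \<circ> op_powr X (op_abs X (adj X (A i))) r))"
    (is "_ \<le> ?c / 4 * ber X (\<Sum>i=1..n. ?S i) + ?c / 2 * (\<Sum>i=1..n. ber X (?T i))")
proof (rule ber_powr_le)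
  have r0: "0 < r" "0 < 2 * r" using r by simp_all
  have pow: "op_powr X (op_abs X (A i)) s \<in> bops X" "op_powr X (op_abs X (adj X (A i))) s \<in> bops X"
    if "i \<in> {1..n}" "0 < s" for i s
    using A[OF that(1)] that(2) by (simp_all add: op_powr_positive op_abs_positive)
  have S: "?S i \<in> bops X" and T: "?T i \<in> bops X" if "i \<in> {1..n}" for i
    using pow[OF that r0(2)] pow[OF that r0(1)] by simp_all
  show "(\<Sum>i=1..n. A i) \<in> bops X" using A by (intro bops_sum)
  have Sb: "(\<Sum>i=1..n. ?S i) \<in> bops X" using S by (intro bops_sum)
  show "0 \<le> ?c / 4 * ber X (\<Sum>i=1..n. ?S i) + ?c / 2 * (\<Sum>i=1..n. ber X (?T i))"
    using ber_nonneg[OF Sb] ber_nonneg[OF T] by (intro add_nonneg_nonneg mult_nonneg_nonneg sum_nonneg) auto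
  fix x assume x: "x \<in> points X"
  let ?k = "nkernel X x"
  note k = nkernel_vecs[OF x] nrm_nkernel[OF x]
  have "cmod (ip X ((\<Sum>i=1..n. A i) ?k) ?k) = cmod (\<Sum>i=1..n. ip X (A i ?k) ?k)"
    unfolding sum_operator_apply by (subst ip_sum_left) (use bops_closed[OF A k(1)] k(1) in auto)
  also have "\<dots> \<le> (\<Sum>i=1..n. cmod (ip X (A i ?k) ?k))" by (rule norm_sum)
  finally have "cmod (ip X ((\<Sum>i=1..n. A i) ?k) ?k) powr (2 * r) \<le>
      (\<Sum>i=1..n. cmod (ip X (A i ?k) ?k)) powr (2 * r)"
    using r by (intro powr_mono2) auto
  also have "\<dots> \<le> ?c * (\<Sum>i=1..n. cmod (ip X (A i ?k) ?k) powr (2 * r))"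
    using power_mean_powr[of "{1..n}" "\<lambda>i. cmod (ip X (A i ?k) ?k)" "2 * r"] n r by simp
  also have "\<dots> \<le> ?c * (\<Sum>i=1..n. Re (ip X (?S i ?k) ?k) / 4 + cmod (ip X (?T i ?k) ?k) / 2)"
    using unit_vector_estimate[OF A r k] by (intro mult_left_mono sum_mono) auto
  also have "(\<Sum>i=1..n. Re (ip X (?S i ?k) ?k) / 4 + cmod (ip X (?T i ?k) ?k) / 2) =
      Re (ip X ((\<Sum>i=1..n. ?S i) ?k) ?k) / 4 + (\<Sum>i=1..n. cmod (ip X (?T i ?k) ?k)) / 2"
  proof -
    have "ip X ((\<Sum>i=1..n. ?S i) ?k) ?k = (\<Sum>i=1..n. ip X (?S i ?k) ?k)"
      unfolding sum_operator_apply
      by (rule ip_sum_left) (rule bops_closed[OF S k(1)], assumption, rule k(1))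
    then show ?thesis by (simp only: Re_sum sum.distrib sum_divide_distrib)
  qed
  also have "\<dots> \<le> ber X (\<Sum>i=1..n. ?S i) / 4 + (\<Sum>i=1..n. ber X (?T i)) / 2"
    using order_trans[OF complex_Re_le_cmod ber_upper[OF Sb x]] ber_upper[OF T x]
    by (intro add_mono divide_right_mono sum_mono) auto
  finally show "cmod (ip X ((\<Sum>i=1..n. A i) ?k) ?k) powr (2 * r) \<le>
      ?c / 4 * ber X (\<Sum>i=1..n. ?S i) + ?c / 2 * (\<Sum>i=1..n. ber X (?T i))"
    by (simp add: mult_left_mono distrib_left)
qed (use r in simp)

end

theorem theorem2p17:
  fixes X :: "'o function_space" and A :: "nat \<Rightarrow> 'o operator" and n :: nat and r :: real
  assumes "rkhs X" and "n \<ge> 1" and "\<And>i. i \<in> {1..n} \<Longrightarrow> A i \<in> bops X" and "r \<ge> 1"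
  shows "ber X (\<Sum>i=1..n. A i) powr (2 * r)
    \<le> real n powr (2 * r - 1) / 4 *
        ber X (\<Sum>i=1..n. op_powr X (op_abs X (A i)) (2 * r) + op_powr X (op_abs X (adj X (A i))) (2 * r))
      + real n powr (2 * r - 1) / 2 *
        (\<Sum>i=1..n. ber X (op_powr X (op_abs X (A i)) r \<circ> op_powr X (op_abs X (adj X (A i))) r))"
  by (rule rkhs.ber_sum_powr_le[OF assms])

end
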